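(* Let $p\in\mathbb N$, $k\in\{2p-1,2p\}$, and let $J$ be the Jacobi operator with perturbation $q\in\mathfrak X_k$. Let $\lambda_{-1}<\dots<\lambda_{-n_-}<-2$ and $2<\lambda_{n_+}<\dots<\lambda_1$ be all its eigenvalues ($n_\pm\ge 0$). Then $$n_-=\#(J^-,(-\infty,-2))\le p,\qquad n_+=\#(J^+,(2,+\infty))\le p,\qquad n_-+n_+\le \lfloor k/2\rfloor+1 .$$ Moreover, the eigenvalues satisfy the chains of inequalities $$\alpha^-_1<\lambda_{-1}<\mu_0<\alpha^+_1<\tau_1<\alpha^-_2<\lambda_{-2}<\mu_1<\dots<\tau_{n_--1}<\alpha^-_{n_-}<\lambda_{-n_-}<\min\{-2,\alpha^+_{n_-}\}$$ and $$\max\{2,\alpha^-_{p-n_++1}\}<\lambda_{n_+}<\alpha^+_{p-n_++1}<\tau_{p-n_++1}<\dots<\mu_{p-2}<\lambda_2<\alpha^+_{p-1}<\tau_{p-1}<\alpha^-_p<\mu_{p-1}<\lambda_1<\alpha^+_p .$$ That is, if $n_-\ge1$, then $\alpha_j^-<\lambda_{-j}<\mu_{j-1}<\alpha_j^+<\tau_j<\alpha_{j+1}^-$ for $1\le j\le n_--1$ and $\alpha^-_{n_-}<\lambda_{-n_-}<\min\{-2,\alpha^+_{n_-}\}$; and if $n_+\ge1$, then $\alpha^+_{p-j}<\tau_{p-j}<\alpha^-_{p-j+1}<\mu_{p-j}<\lambda_j<\alpha^+_{p-j+1}$ for $1\le j\le n_+-1$ and $\max\{2,\alpha^-_{p-n_++1}\}<\lambda_{n_+}<\alpha^+_{p-n_++1}$.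 In particular, if $k>1$, then $J$ has at least $p-1$ resonances (counted with multiplicity).
   Context: $\mathbb N=\{1,2,\dots\}$. For real bounded sequences $(a_x)_{x\ge1}$, $(b_x)_{x\ge1}$ with $a_x>0$, the Jacobi operator $J$ on $\ell^2(\mathbb N)$ is $(Jf)_x=a_xf_{x+1}+b_xf_x+a_{x-1}f_{x-1}$, $x\ge1$, with $f_0=0$ formally and $a_0=1$. Its perturbation is the sequence $q=q(a,b)=(b_1,a_1-1,b_2,a_2-1,\dots)$. For $k\in\mathbb N$, $\mathfrak X_k=\{h\in\ell^\infty(\mathbb N)\ \text{real}:\ h_{2x}>-1\ \forall x\in\mathbb N,\ h_k\ne0,\ h_x=0\ \forall x>k\}$. So if $k\in\{2p-1,2p\}$ then $a_x=1,b_x=0$ for $x>p$; if $k=2p-1$ then $a_p=1,b_p\neq0$; if $k=2p$ then $a_p\ne1$. The spectrum of $J$ is $[-2,2]$ (absolutely continuous) together with finitely many simple eigenvalues in $\mathbb R\setminus[-2,2]$. $J_p$ is the $p\times p$ Jacobi matrix with diagonal $b_1,\dots,b_p$ and off-diagonal $a_1,\dots,a_{p-1}$; its eigenvalues are $\mu_0<\dots<\mu_{p-1}$. $J_{p,1}$ is $J_p$ with the last row and column deleted; its eigenvalues are $\tau_1<\dots<\tau_{p-1}$. $J^\pm$ is obtained from $J_p$ by replacing the $(p,p)$ entry $b_p$ by $b_p\pm a_p^2$; its eigenvalues are $\alpha_1^\pm<\dots<\alpha_p^\pm$. $\#(A,(c,d))$ is the number of eigenvalues of $A$ in $(c,d)$,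 counting multiplicity. The Jost solution $(\psi_x(z))_{x\ge0}$, $z\neq 0$, is defined by $a_{x-1}\psi_{x-1}+a_x\psi_{x+1}+b_x\psi_x=(z+z^{-1})\psi_x$ for $x\ge1$ and $\psi_x(z)=z^x$ for all $x>p$. The Jost function $\psi_0$ is a real polynomial of degree $k$. Its zeros in $\{|z|\ge1\}$ are called resonances. *)

theory Defs
  imports
    "HOL-Complex_Analysis.Complex_Analysis"
    "Jordan_Normal_Form.Char_Poly"
begin

(* Sequences indexed by N = {1,2,...} are functions on nat whose value at 0 carries no
   information, except for the conventions a 0 = 1 and f 0 = 0 that extend the three-term
   recurrence to x = 1. *)

definition perturbation :: "(nat \<Rightarrow> real) \<Rightarrow> (nat \<Rightarrow> real) \<Rightarrow> nat \<Rightarrow> real" where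
  "perturbation a b n = (if odd n then b ((n + 1) div 2) else a (n div 2) - 1)"

definition X_class :: "nat \<Rightarrow> (nat \<Rightarrow> real) set" where
  "X_class k = {h. bounded (h ` {1..}) \<and> (\<forall>x\<ge>1. h (2 * x) > -1) \<and> h k \<noteq> 0 \<and> (\<forall>x>k. h x = 0)}"

definition ell2 :: "(nat \<Rightarrow> complex) set" where
  "ell2 = {f. f 0 = 0 \<and> summable (\<lambda>x. (cmod (f x))\<^sup>2)}"

definition jacobi_op :: "(nat \<Rightarrow> real) \<Rightarrow> (nat \<Rightarrow> real) \<Rightarrow> (nat \<Rightarrow> complex) \<Rightarrow> nat \<Rightarrow> complex" where
  "jacobi_op a b f x =
     (if x = 0 then 0
      else of_real (a x) * f (x + 1) + of_real (b x) * f x + of_real (a (x - 1)) * f (x - 1))"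

definition jacobi_eigenvalue :: "(nat \<Rightarrow> real) \<Rightarrow> (nat \<Rightarrow> real) \<Rightarrow> complex \<Rightarrow> bool" where
  "jacobi_eigenvalue a b e \<longleftrightarrow>
     (\<exists>f\<in>ell2. f \<noteq> (\<lambda>_. 0) \<and> jacobi_op a b f = (\<lambda>x. e * f x))"

(* Matrix entries are indexed from 0, so entry (i,i) is b (i+1). *)
definition jacobi_mat :: "(nat \<Rightarrow> real) \<Rightarrow> (nat \<Rightarrow> real) \<Rightarrow> nat \<Rightarrow> real mat" where
  "jacobi_mat a b p = mat p p (\<lambda>(i, j).
     if i = j then b (i + 1)
     else if j = i + 1 then a (i + 1)
     else if i = j + 1 then a (j + 1)
     else 0)"

definition jacobi_mat_trunc :: "(nat \<Rightarrow> real) \<Rightarrow> (nat \<Rightarrow> real) \<Rightarrow> nat \<Rightarrow> real mat" where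
  "jacobi_mat_trunc a b p = mat_delete (jacobi_mat a b p) (p - 1) (p - 1)"

definition jacobi_mat_plus :: "(nat \<Rightarrow> real) \<Rightarrow> (nat \<Rightarrow> real) \<Rightarrow> nat \<Rightarrow> real mat" where
  "jacobi_mat_plus a b p = mat p p (\<lambda>(i, j).
     if i = p - 1 \<and> j = p - 1 then b p + (a p)\<^sup>2 else jacobi_mat a b p $$ (i, j))"

definition jacobi_mat_minus :: "(nat \<Rightarrow> real) \<Rightarrow> (nat \<Rightarrow> real) \<Rightarrow> nat \<Rightarrow> real mat" where
  "jacobi_mat_minus a b p = mat p p (\<lambda>(i, j).
     if i = p - 1 \<and> j = p - 1 then b p - (a p)\<^sup>2 else jacobi_mat a b p $$ (i, j))"

definition eigenvalue_count :: "real mat \<Rightarrow> real set \<Rightarrow> nat" where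
  "eigenvalue_count A S =
     (\<Sum>e | eigenvalue A e \<and> e \<in> S. Polynomial.order e (char_poly A))"

definition eigenvalue_enum :: "real mat \<Rightarrow> nat set \<Rightarrow> (nat \<Rightarrow> real) \<Rightarrow> bool" where
  "eigenvalue_enum A I ev \<longleftrightarrow> strict_mono_on I ev \<and> ev ` I = {e. eigenvalue A e}"

definition jost_solution ::
  "(nat \<Rightarrow> real) \<Rightarrow> (nat \<Rightarrow> real) \<Rightarrow> nat \<Rightarrow> (nat \<Rightarrow> complex \<Rightarrow> complex) \<Rightarrow> bool" where
  "jost_solution a b p \<psi> \<longleftrightarrow>
     (\<forall>z. z \<noteq> 0 \<longrightarrow>
        (\<forall>x\<ge>1. of_real (a (x - 1)) * \<psi> (x - 1) z + of_real (a x) * \<psi> (x + 1) z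
                 + of_real (b x) * \<psi> x z = (z + inverse z) * \<psi> x z) \<and>
        (\<forall>x>p. \<psi> x z = z ^ x))"

definition resonances :: "(complex \<Rightarrow> complex) \<Rightarrow> complex set" where
  "resonances F = {z. cmod z \<ge> 1 \<and> F z = 0}"

(* Infinitely many zeros would give the value 0, so lower bounds on the count remain meaningful. *)
definition resonance_count :: "(complex \<Rightarrow> complex) \<Rightarrow> nat" where
  "resonance_count F = (\<Sum>z\<in>resonances F. nat (zorder F z))"

end

theory Submission
  imports Defs
begin

text \<open>
  Let \<open>D\<^sub>n\<close> be the characteristic polynomial of the leading \<open>n \<times> n\<close> block of the Jacobi matrix,
  \<open>m = D\<^sub>p / D\<^sub>p\<^sub>-\<^sub>1\<close> and \<open>A = a\<^sub>p\<^sup>2\<close>. Outside \<open>[-2, 2]\<close> write \<open>\<lambda> = z + 1/z\<close> with \<open>|z| < 1\<close>. A solution of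
  the eigenvalue equation that vanishes at \<open>0\<close> is a multiple of \<open>D\<^sub>x\<^sub>-\<^sub>1(\<lambda>) / (a\<^sub>0 \<cdots> a\<^sub>x\<^sub>-\<^sub>1)\<close>, and it is square
  summable iff it continues beyond \<open>p\<close> as a multiple of \<open>z\<^sup>x\<close>. This means \<open>m(\<lambda>) = A z\<close>. In the same
  language the eigenvalues of \<open>J\<^sub>p\<close>, \<open>J\<^sup>+\<close>, \<open>J\<^sup>-\<close> are the solutions of \<open>m = 0\<close>, \<open>m = A\<close>, \<open>m = -A\<close>, and
  those of the truncation are the poles of \<open>m\<close>. All inequalities thus compare the points at which \<open>m\<close>
  meets certain curves.

  The recurrence for \<open>D\<^sub>n\<close> gives the Wronskian bound \<open>D\<^sub>p' D\<^sub>p\<^sub>-\<^sub>1 - D\<^sub>p D\<^sub>p\<^sub>-\<^sub>1' \<ge> D\<^sub>p\<^sub>-\<^sub>1\<^sup>2\<close>, so \<open>m\<close> has slope at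
  least \<open>1\<close> between consecutive poles (\<open>jacobi_ratio_slope\<close>). The poles cut the line into \<open>p\<close> cells;
  in each of them \<open>m\<close> takes a given value at most once, and since \<open>p\<close> distinct solutions of \<open>m = c\<close>
  are given, each cell contains exactly one (\<open>cell_level_point\<close>). On \<open>(-\<infinity>, -2]\<close> the function
  \<open>\<lambda> \<mapsto> A z(\<lambda>)\<close> decreases from \<open>0\<close> to \<open>-A\<close>. Hence it meets \<open>m\<close> at most once in each cell, in the part
  where \<open>-A < m < 0\<close>, and it does so exactly in those cells whose point \<open>\<alpha>\<^sup>-\<close> lies below \<open>-2\<close>
  (\<open>crossings_below\<close>). The half-line \<open>[2, \<infinity>)\<close> is the mirror image (\<open>crossings_above\<close>).

  Counting cells gives \<open>n\<^sub>- + n\<^sub>+ \<le> p + 1\<close>. If \<open>k = 2p - 1\<close>, then \<open>A = 1\<close>, and equality would put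
  \<open>\<alpha>\<^sup>- < -2\<close> and \<open>\<alpha>\<^sup>+ > 2\<close> into one cell, although the slope bound gives \<open>\<alpha>\<^sup>+ - \<alpha>\<^sup>- \<le> 2A = 2\<close>.

  For the resonances, a Casoratian shows that \<open>\<psi>\<^sub>0(z)\<close> is \<open>z\<^sup>p (D\<^sub>p - A z D\<^sub>p\<^sub>-\<^sub>1)(z + 1/z)\<close> up to a nonzero
  factor (\<open>jost_function_eq\<close>). This is a polynomial of degree at least \<open>k\<close>, nonzero at \<open>0\<close>, whose zeros
  in the open unit disc correspond to eigenvalues, are therefore real, and are simple by the Wronskian
  bound (\<open>jost_poly_simple_root\<close>). At least \<open>k - (\<lfloor>k/2\<rfloor> + 1) = p - 1\<close> zeros remain for \<open>|z| \<ge> 1\<close>.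
\<close>

section \<open>Polynomials attached to a Jacobi matrix\<close>

(* Of the indexing operators written with this symbol, only the one for vectors of matrices is meant here. *)
no_notation fps_nth (infixl "$" 75)
no_notation vec_nth (infixl "$" 90)

text \<open>
  The index is shifted: \<open>jacobi_poly a b (n + 1)\<close> is the characteristic polynomial of the leading
  \<open>n \<times> n\<close> block. With the zero polynomial at index \<open>0\<close> the sequence satisfies the same boundary
  condition as the eigenfunctions, and blocks of size \<open>1\<close> need no separate treatment. The coefficient
  field is kept general because interlacing is a matter of real numbers whereas the Jost function is
  complex.
\<close>

fun jacobi_poly ::
  "(nat \<Rightarrow> real) \<Rightarrow> (nat \<Rightarrow> real) \<Rightarrow> nat \<Rightarrow> 'a::real_normed_field poly" where
  "jacobi_poly a b 0 = 0"
| "jacobi_poly a b (Suc 0) = 1"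
| "jacobi_poly a b (Suc (Suc n)) =
     [:- of_real (b (Suc n)), 1:] * jacobi_poly a b (Suc n)
     - Polynomial.smult (of_real ((a n)\<^sup>2)) (jacobi_poly a b n)"

lemma jacobi_poly_cong:
  assumes "\<And>i. 1 \<le> i \<Longrightarrow> i < n \<Longrightarrow> b i = b' i"
  shows "jacobi_poly a b n = (jacobi_poly a b' n :: 'a::real_normed_field poly)"
  using assms
proof (induction a b n rule: jacobi_poly.induct[case_names 0 1 SS])
  case (SS a b n)
  have "jacobi_poly a b (Suc n) = (jacobi_poly a b' (Suc n) :: 'a poly)"
    and "jacobi_poly a b n = (jacobi_poly a b' n :: 'a poly)"
    and "b (Suc n) = b' (Suc n)"
    using SS by simp_all
  then show ?case
    by (simp only: jacobi_poly.simps)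
qed auto

text \<open>
  Read backwards, the recurrence would carry a common root down to the constant polynomial \<open>1\<close>.
\<close>

lemma jacobi_poly_no_common_root:
  assumes pos: "\<And>n. 0 < a n"
    and "poly (jacobi_poly a b (Suc n)) x = 0"
  shows "poly (jacobi_poly a b n) (x :: 'a::real_normed_field) \<noteq> 0"
  using assms(2)
proof (induction n)
  case (Suc n)
  show ?case
  proof
    assume g: "poly (jacobi_poly a b (Suc n)) x = 0"
    have "(of_real ((a n)\<^sup>2) :: 'a) \<noteq> 0"
      using pos[of n] by simp
    then show False
      using Suc g by simp
  qed
qed auto

text \<open>
  In the notation of the statement, the Wronskian obeys \<open>W\<^sub>n\<^sub>+\<^sub>1 = D\<^sub>n\<^sub>+\<^sub>1\<^sup>2 + a\<^sub>n\<^sup>2 W\<^sub>n\<close>, so it never drops below its leading square.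
  This is the source of both the interlacing and the simplicity of the zeros of the Jost function.
\<close>

lemma jacobi_poly_wronskian_ge:
  fixes a b :: "nat \<Rightarrow> real" and x :: real
  defines "D \<equiv> \<lambda>n. poly (jacobi_poly a b n) x"
    and "D' \<equiv> \<lambda>n. poly (pderiv (jacobi_poly a b n)) x"
  shows "(D n)\<^sup>2 \<le> D' (Suc n) * D n - D (Suc n) * D' n"
proof (induction n)
  case 0
  show ?case by (simp add: D_def D'_def)
next
  case (Suc n)
  have step: "D' (Suc (Suc n)) * D (Suc n) - D (Suc (Suc n)) * D' (Suc n) =
      (D (Suc n))\<^sup>2 + (a n)\<^sup>2 * (D' (Suc n) * D n - D (Suc n) * D' n)"
    unfolding D_def D'_def jacobi_poly.simps pderiv_mult pderiv_diff pderiv_smult pderiv_pCons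
    by (simp add: algebra_simps power2_eq_square)
  have "0 \<le> D' (Suc n) * D n - D (Suc n) * D' n"
    using Suc zero_le_power2[of "D n"] by linarith
  then show ?case
    unfolding step by simp
qed

text \<open>
  The boundary condition \<open>u 0 = 0\<close> leaves a one-dimensional solution space; clearing the
  denominators \<open>a\<^sub>0 \<cdots> a\<^sub>x\<^sub>-\<^sub>1\<close> turns the normalised solution into a polynomial in \<open>e\<close>.
\<close>

lemma recurrence_solution_eq:
  fixes u :: "nat \<Rightarrow> 'a::real_normed_field"
  assumes u0: "u 0 = 0"
    and rec: "\<And>x. 1 \<le> x \<Longrightarrow> x \<le> n \<Longrightarrow>
      of_real (a (x - 1)) * u (x - 1) + of_real (b x) * u x + of_real (a x) * u (Suc x) = e * u x"
    and "x \<le> Suc n"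
  shows "(\<Prod>i<x. of_real (a i)) * u x = of_real (a 0) * u 1 * poly (jacobi_poly a b x) e"
  using rec assms(3)
proof (induction a b x rule: jacobi_poly.induct[case_names 0 1 SS])
  case (SS a b x)
  let ?P = "\<Prod>i<x. of_real (a i) :: 'a" and ?D = "\<lambda>n. poly (jacobi_poly a b n) e"
  have "(\<Prod>i<Suc (Suc x). of_real (a i)) * u (Suc (Suc x))
      = of_real (a x) * ?P * (of_real (a (Suc x)) * u (Suc (Suc x)))"
    by (simp add: mult_ac)
  also have "of_real (a (Suc x)) * u (Suc (Suc x))
      = (e - of_real (b (Suc x))) * u (Suc x) - of_real (a x) * u x"
    using SS.prems(1)[of "Suc x"] SS.prems(2) by (simp add: algebra_simps)
  also have "of_real (a x) * ?P * \<dots> = (e - of_real (b (Suc x))) * ((\<Prod>i<Suc x. of_real (a i)) * u (Suc x))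
      - of_real ((a x)\<^sup>2) * (?P * u x)"
    by (simp add: algebra_simps power2_eq_square)
  also have "\<dots> = of_real (a 0) * u 1 * ?D (Suc (Suc x))"
    using SS.IH SS.prems by (simp add: algebra_simps)
  finally show ?case .
qed (auto simp: u0)

text \<open>
  Existence, to go with the uniqueness stated above.
\<close>

lemma jacobi_poly_solution:
  fixes a b :: "nat \<Rightarrow> real" and e :: "'a::real_normed_field"
  assumes pos: "\<And>n. 0 < a n" and x: "1 \<le> x"
  defines "\<phi> \<equiv> \<lambda>x. poly (jacobi_poly a b x) e / (\<Prod>i<x. of_real (a i))"
  shows "of_real (a (x - 1)) * \<phi> (x - 1) + of_real (b x) * \<phi> x + of_real (a x) * \<phi> (Suc x) = e * \<phi> x"
proof -
  obtain n where n: "x = Suc n"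
    using x by (cases x) auto
  have nz: "of_real (a i) \<noteq> (0::'a)" for i
    using pos[of i] by simp
  then have "(\<Prod>i<n. of_real (a i)) \<noteq> (0::'a)"
    by simp
  then show ?thesis
    using nz[of n] nz[of "Suc n"] unfolding n \<phi>_def
    by (simp add: divide_simps) (simp add: algebra_simps power2_eq_square)
qed

lemma jacobi_mat_mult_vec:
  assumes "v \<in> carrier_vec n" "i < n"
  shows "(jacobi_mat a b n *\<^sub>v v) $ i =
    (if i = 0 then 0 else a i * v $ (i - 1)) + b (Suc i) * v $ i
      + (if Suc i < n then a (Suc i) * v $ (Suc i) else 0)"
proof -
  have "(jacobi_mat a b n *\<^sub>v v) $ i = (\<Sum>j\<in>{0..<n}.
      (if i = 0 then 0 else if j = i - 1 then a i * v $ (i - 1) else 0) + (if j = i then b (Suc i) * v $ i else 0)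
      + (if j = Suc i then a (Suc i) * v $ (Suc i) else 0))"
    using assms by (auto simp: jacobi_mat_def scalar_prod_def intro!: sum.cong)
  also have "\<dots> = (if i = 0 then 0 else a i * v $ (i - 1)) + b (Suc i) * v $ i
      + (if Suc i < n then a (Suc i) * v $ (Suc i) else 0)"
    using assms(2) by (cases "i = 0") (auto simp: sum.distrib)
  finally show ?thesis .
qed

text \<open>
  An eigenvector is a solution of the recurrence that vanishes at both \<open>0\<close> and \<open>n + 1\<close>, and the value
  at \<open>n + 1\<close> is a multiple of the polynomial. No determinant has to be expanded.
\<close>

lemma eigenvalue_jacobi_mat_iff:
  assumes pos: "\<And>n. 0 < a n"
  shows "eigenvalue (jacobi_mat a b n) e \<longleftrightarrow> poly (jacobi_poly a b (Suc n)) e = 0"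
proof
  assume "eigenvalue (jacobi_mat a b n) e"
  then obtain v where v: "v \<in> carrier_vec n" "v \<noteq> 0\<^sub>v n"
    and ev: "jacobi_mat a b n *\<^sub>v v = e \<cdot>\<^sub>v v"
    by (auto simp: eigenvalue_def eigenvector_def jacobi_mat_def)
  \<comment> \<open>Padding the eigenvector with zeros on both sides turns the matrix equation into the recurrence.\<close>
  define u where "u x = (if x = 0 \<or> n < x then 0 else v $ (x - 1))" for x
  have rec: "of_real (a (x - 1)) * u (x - 1) + of_real (b x) * u x + of_real (a x) * u (Suc x) = e * u x"
    if "1 \<le> x" "x \<le> n" for x
    using arg_cong[OF ev, of "\<lambda>w. w $ (x - 1)"] jacobi_mat_mult_vec[OF v(1), of "x - 1" a b] that v(1)
    by (cases x) (auto simp: u_def algebra_simps split: if_splits)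
  have sol: "(\<Prod>i<x. a i) * u x = a 0 * u 1 * poly (jacobi_poly a b x) e" if "x \<le> Suc n" for x
    using recurrence_solution_eq[of u n a b e x] rec that by (simp add: u_def)
  have prod: "(\<Prod>i<x. a i) \<noteq> 0" for x
    using pos by (simp add: less_imp_neq[THEN not_sym])
  have "u 1 \<noteq> 0"
  proof
    assume "u 1 = 0"
    then have u: "u x = 0" if "x \<le> Suc n" for x
      using sol[OF that] prod[of x] by simp
    have "v $ i = 0" if "i < n" for i
      using u[of "Suc i"] that by (simp add: u_def)
    then show False
      using v by (auto simp: vec_eq_iff)
  qed
  moreover have "u (Suc n) = 0"
    by (simp add: u_def)
  ultimately show "poly (jacobi_poly a b (Suc n)) e = 0"
    using sol[of "Suc n"] pos[of 0] by simp
next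
  assume root: "poly (jacobi_poly a b (Suc n)) e = 0"
  then have n: "0 < n"
    by (cases n) auto
  define \<phi> where "\<phi> x = poly (jacobi_poly a b x) e / (\<Prod>i<x. of_real (a i))" for x
  have rec: "a (x - 1) * \<phi> (x - 1) + b x * \<phi> x + a x * \<phi> (Suc x) = e * \<phi> x" if "1 \<le> x" for x
    using jacobi_poly_solution[of a x b e] pos that by (simp add: \<phi>_def)
  have ends: "\<phi> 0 = 0" "\<phi> (Suc n) = 0"
    using root by (simp_all add: \<phi>_def)
  define v where "v = vec n (\<lambda>i. \<phi> (Suc i))"
  have v: "v \<in> carrier_vec n"
    by (simp add: v_def)
  have "v $ 0 \<noteq> 0"
    using n pos[of 0] by (simp add: v_def \<phi>_def)
  then have "v \<noteq> 0\<^sub>v n"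
    using n by auto
  moreover have "jacobi_mat a b n *\<^sub>v v = e \<cdot>\<^sub>v v"
  proof (rule eq_vecI)
    fix i assume "i < dim_vec (e \<cdot>\<^sub>v v)"
    then have i: "i < n"
      by (simp add: v_def)
    have last: "\<phi> (Suc (Suc i)) = 0" if "\<not> Suc i < n"
    proof -
      have "Suc i = n"
        using that i by simp
      then show ?thesis
        using ends by simp
    qed
    show "(jacobi_mat a b n *\<^sub>v v) $ i = (e \<cdot>\<^sub>v v) $ i"
      using rec[of "Suc i"] i ends(1) last jacobi_mat_mult_vec[OF v i, of a b]
      by (cases "i = 0"; cases "Suc i < n") (auto simp: v_def)
  qed (simp add: v_def jacobi_mat_def)
  ultimately show "eigenvalue (jacobi_mat a b n) e"
    using v by (auto simp: eigenvalue_def eigenvector_def jacobi_mat_def)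
qed

lemma jacobi_mat_plus_eq:
  "jacobi_mat_plus a b p = jacobi_mat a (b(p := b p + (a p)\<^sup>2)) p"
  by (auto simp: jacobi_mat_plus_def jacobi_mat_def intro!: eq_matI)

lemma jacobi_mat_minus_eq:
  "jacobi_mat_minus a b p = jacobi_mat a (b(p := b p - (a p)\<^sup>2)) p"
  by (auto simp: jacobi_mat_minus_def jacobi_mat_def intro!: eq_matI)

lemma jacobi_mat_trunc_eq: "jacobi_mat_trunc a b p = jacobi_mat a b (p - 1)"
  by (auto simp: jacobi_mat_trunc_def jacobi_mat_def mat_delete_def)

text \<open>
  The matrices \<open>J\<^sup>+\<close> and \<open>J\<^sup>-\<close> differ from \<open>J\<^sub>p\<close> only in the last diagonal entry, which enters only the
  last step of the recurrence. So their eigenvalues are points where \<open>D\<^sub>p / D\<^sub>p\<^sub>-\<^sub>1\<close> takes a given value.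
\<close>

lemma jacobi_poly_last_shift:
  assumes "1 \<le> p"
  shows "jacobi_poly a (b(p := b p + c)) (Suc p) =
    (jacobi_poly a b (Suc p) :: 'a::real_normed_field poly) - Polynomial.smult (of_real c) (jacobi_poly a b p)"
proof -
  obtain n where n: "p = Suc n"
    using assms by (cases p) auto
  define b' where "b' = b(p := b p + c)"
  have "jacobi_poly a b' m = (jacobi_poly a b m :: 'a poly)" if "m \<le> p" for m
    using that by (intro jacobi_poly_cong) (auto simp: b'_def)
  then have eq: "jacobi_poly a b' n = (jacobi_poly a b n :: 'a poly)"
    "jacobi_poly a b' (Suc n) = (jacobi_poly a b (Suc n) :: 'a poly)"
    by (simp_all add: n)
  have "b' (Suc n) = b (Suc n) + c"
    by (simp add: b'_def n)
  then show ?thesis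
    unfolding b'_def[symmetric] unfolding n jacobi_poly.simps eq
    by (simp add: algebra_simps flip: smult_add_left)
qed

text \<open>
  There are \<open>n\<close> distinct roots and the degree is \<open>n\<close>, which leaves no room for a multiple root.
\<close>

lemma order_char_poly_eq_1:
  fixes A :: "'a::field mat"
  assumes A: "A \<in> carrier_mat n n" and card: "card {e. eigenvalue A e} = n"
    and e: "eigenvalue A e"
  shows "Polynomial.order e (char_poly A) = 1"
proof -
  let ?E = "{e. eigenvalue A e}" and ?ord = "\<lambda>e. Polynomial.order e (char_poly A)"
  have roots: "?E = {e. poly (char_poly A) e = 0}"
    using eigenvalue_root_char_poly[OF A] by simp
  have deg: "degree (char_poly A) = n" and nz: "char_poly A \<noteq> 0"
    using degree_monic_char_poly[OF A] by auto
  have fin: "finite ?E"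
    unfolding roots using nz by (rule poly_roots_finite)
  have ge: "1 \<le> ?ord x" if "x \<in> ?E" for x
    using that nz order_root[of "char_poly A" x] unfolding roots by (auto simp: Suc_le_eq)
  have "(\<Sum>x\<in>?E. ?ord x) \<le> (\<Sum>x\<in>?E. 1)"
    using sum_order_le_degree[OF nz] card deg by (simp add: roots)
  then have "\<not> 1 < ?ord e"
    using sum_strict_mono_ex1[OF fin, of "\<lambda>_. 1" ?ord] ge e by fastforce
  then show ?thesis
    using ge[of e] e by simp
qed

lemma eigenvalue_count_enum:
  assumes A: "A \<in> carrier_mat n n" and enum: "eigenvalue_enum A {1..n} r"
  shows "eigenvalue_count A S = card {j \<in> {1..n}. r j \<in> S}"
proof -
  have inj: "inj_on r {1..n}" and im: "r ` {1..n} = {e. eigenvalue A e}"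
    using enum by (auto simp: eigenvalue_enum_def intro: strict_mono_on_imp_inj_on)
  have "card {e. eigenvalue A e} = n"
    using card_image[OF inj] im by simp
  then have "eigenvalue_count A S = card {e. eigenvalue A e \<and> e \<in> S}"
    unfolding eigenvalue_count_def using order_char_poly_eq_1[OF A] by simp
  also have "{e. eigenvalue A e \<and> e \<in> S} = r ` {1..n} \<inter> S"
    using im by auto
  also have "\<dots> = r ` {j \<in> {1..n}. r j \<in> S}"
    by auto
  also have "card \<dots> = card {j \<in> {1..n}. r j \<in> S}"
    by (intro card_image inj_on_subset[OF inj]) auto
  finally show ?thesis .
qed

text \<open>
  By the quotient rule the derivative is the Wronskian divided by the square of the denominator.
\<close>

lemma jacobi_ratio_slope:
  fixes a b :: "nat \<Rightarrow> real" and x y :: real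
  assumes xy: "x \<le> y" and none: "\<And>w. w \<in> {x..y} \<Longrightarrow> poly (jacobi_poly a b p) w \<noteq> 0"
  defines "m \<equiv> \<lambda>x. poly (jacobi_poly a b (Suc p)) x / poly (jacobi_poly a b p) x"
  shows "y - x \<le> m y - m x"
proof -
  let ?f = "jacobi_poly a b (Suc p) :: real poly" and ?g = "jacobi_poly a b p :: real poly"
  have "m x - x \<le> m y - y"
  proof (rule DERIV_nonneg_imp_nondecreasing[OF xy])
    fix w assume "x \<le> w" "w \<le> y"
    then have g: "poly ?g w \<noteq> 0"
      using none by simp
    let ?W = "poly (pderiv ?f) w * poly ?g w - poly ?f w * poly (pderiv ?g) w"
    have "((\<lambda>w. m w - w) has_real_derivative ?W / (poly ?g w * poly ?g w) - 1) (at w)"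
      unfolding m_def by (intro DERIV_diff DERIV_divide poly_DERIV DERIV_ident g)
    moreover have "0 \<le> ?W / (poly ?g w * poly ?g w) - 1"
    proof -
      have "0 < poly ?g w * poly ?g w"
        using g by (simp add: zero_less_mult_iff) argo
      then show ?thesis
        using jacobi_poly_wronskian_ge[of a b p w] by (simp add: le_divide_eq power2_eq_square)
    qed
    ultimately show "\<exists>D. ((\<lambda>w. m w - w) has_real_derivative D) (at w) \<and> 0 \<le> D"
      by blast
  qed
  then show ?thesis
    by simp
qed

section \<open>Crossings with an increasing function between its poles\<close>

text \<open>
  A strictly increasing map onto an initial segment can only be the identity. With it, monotone
  enumerations are matched with the numbers of the cells containing their values.
\<close>

lemma strict_mono_on_atLeastAtMost_onto:
  fixes s :: "nat \<Rightarrow> nat"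
  assumes mono: "strict_mono_on {1..n} s" and onto: "s ` {1..n} = {1..m}"
  shows "n = m" and "\<And>j. j \<in> {1..n} \<Longrightarrow> s j = j"
proof -
  have "inj_on s {1..n}"
    using mono by (rule strict_mono_on_imp_inj_on)
  then have "card (s ` {1..n}) = n"
    by (simp add: card_image)
  then show nm: "n = m"
    using onto by simp
  have less: "s i < s j" if "1 \<le> i" "i < j" "j \<le> n" for i j
    using strict_mono_onD[OF mono, of i j] that by simp
  have lower: "j \<le> s j" if "1 \<le> j" "j \<le> n" for j
    using that
  proof (induction j rule: dec_induct)
    case base
    then have "s 1 \<in> s ` {1..n}"
      by simp
    then show ?case
      unfolding onto by simp
  next
    case (step j)
    then show ?case
      using less[of j "Suc j"] by simp
  qed
  have upper: "s j \<le> j" if "1 \<le> j" "j \<le> n" for j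
    using that(2,1)
  proof (induction j rule: inc_induct)
    case base
    then have "s n \<in> s ` {1..n}"
      by simp
    then have "s n \<in> {1..m}"
      unfolding onto .
    then show ?case
      using nm by simp
  next
    case (step j)
    then show ?case
      using less[of j "Suc j"] by simp
  qed
  show "s j = j" if "j \<in> {1..n}" for j
    using lower[of j] upper[of j] that by simp
qed

lemma initial_segment_eq:
  fixes S :: "nat set"
  assumes "finite S" "S \<subseteq> {1..}" and down: "\<And>i j. j \<in> S \<Longrightarrow> 1 \<le> i \<Longrightarrow> i \<le> j \<Longrightarrow> i \<in> S"
  shows "S = {1..card S}"
proof (cases "S = {}")
  case False
  have "S = {1..Max S}"
  proof (intro equalityI subsetI)
    fix i assume "i \<in> S"
    then show "i \<in> {1..Max S}"
      using assms(1,2) by auto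
  next
    fix i assume "i \<in> {1..Max S}"
    then show "i \<in> S"
      using down[OF Max_in[OF assms(1) False], of i] by simp
  qed
  then show ?thesis
    by (metis card_atLeastAtMost diff_Suc_1)
qed simp

text \<open>
  The properties of \<open>D\<^sub>p / D\<^sub>p\<^sub>-\<^sub>1\<close> on which the interlacing rests. What places the points of a
  level set is that \<open>p\<close> of them are given, rather than the behaviour of \<open>m\<close> near the poles.
\<close>

locale increasing_branches =
  fixes p :: nat and \<tau> :: "nat \<Rightarrow> real" and m :: "real \<Rightarrow> real"
  assumes p_pos: "1 \<le> p"
    and pole_mono: "strict_mono_on {1..<p} \<tau>"
    and slope: "\<And>x y. x \<le> y \<Longrightarrow> {x..y} \<inter> \<tau> ` {1..<p} = {} \<Longrightarrow> y - x \<le> m y - m x"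
    and cont: "\<And>x y. {x..y} \<inter> \<tau> ` {1..<p} = {} \<Longrightarrow> continuous_on {x..y} m"
begin

abbreviation poles :: "real set" where
  "poles \<equiv> \<tau> ` {1..<p}"

text \<open>
  The number of the interval between consecutive poles that contains \<open>x\<close>, counted from \<open>1\<close>. A pole
  itself gets the number of the interval to its left.
\<close>

definition cell :: "real \<Rightarrow> nat" where
  "cell x = Suc (card {i \<in> {1..<p}. \<tau> i < x})"

lemma cell_mono: "x \<le> y \<Longrightarrow> cell x \<le> cell y"
  unfolding cell_def by (auto intro!: card_mono)

lemma cell_range: "cell x \<in> {1..p}"
proof -
  have "card {i \<in> {1..<p}. \<tau> i < x} \<le> card {1..<p}"
    by (intro card_mono) auto
  then show ?thesis
    using p_pos by (auto simp: cell_def)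
qed

text \<open>
  The poles below \<open>x\<close> form an initial segment of the enumeration, so their number tells which they
  are.
\<close>

lemma pole_less_iff:
  assumes i: "i \<in> {1..<p}"
  shows "\<tau> i < x \<longleftrightarrow> i < cell x"
proof -
  let ?S = "{i \<in> {1..<p}. \<tau> i < x}"
  have "?S = {1..card ?S}"
  proof (rule initial_segment_eq)
    fix i j assume j: "j \<in> ?S" and i: "1 \<le> i" "i \<le> j"
    then have "\<tau> i \<le> \<tau> j"
      using strict_mono_onD[OF pole_mono, of i j] by (cases "i = j") auto
    then show "i \<in> ?S"
      using i j by simp
  qed auto
  then have "i \<in> ?S \<longleftrightarrow> i \<in> {1..card ?S}"
    by (rule arg_cong)
  then show ?thesis
    using i by (simp add: cell_def less_Suc_eq_le)
qed

lemma same_cell_no_pole: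
  assumes "y \<notin> poles" "x \<notin> poles" "cell x = cell y"
  shows "{x..y} \<inter> poles = {}"
proof (rule ccontr)
  assume "{x..y} \<inter> poles \<noteq> {}"
  then obtain i where i: "i \<in> {1..<p}" "x \<le> \<tau> i" "\<tau> i \<le> y"
    by (auto simp del: atLeastLessThan_iff)
  then have "\<not> \<tau> i < x" "\<tau> i < y"
    using assms by (auto simp: order_less_le)
  then show False
    using pole_less_iff[OF i(1)] assms(3) by auto
qed

lemma same_cell_slope:
  assumes "y \<notin> poles" "x \<notin> poles" "cell x = cell y" "x \<le> y"
  shows "y - x \<le> m y - m x"
  using slope[OF assms(4) same_cell_no_pole[OF assms(1-3)]] .

lemma same_cell_less_iff:
  assumes "y \<notin> poles" "x \<notin> poles" "cell x = cell y"
  shows "x < y \<longleftrightarrow> m x < m y"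
  using same_cell_slope[of x y] same_cell_slope[of y x] assms by fastforce

definition level_points :: "real \<Rightarrow> (nat \<Rightarrow> real) \<Rightarrow> bool" where
  "level_points c r \<longleftrightarrow>
     strict_mono_on {1..p} r \<and> (\<forall>j\<in>{1..p}. r j \<notin> poles \<and> m (r j) = c)"

text \<open>
  Two points of one level set cannot share a cell, so the cell numbers increase strictly along the
  \<open>p\<close> given points; there being just \<open>p\<close> cells, the \<open>j\<close>-th point lies in the \<open>j\<close>-th cell.
\<close>

lemma cell_level_point:
  assumes r: "level_points c r" and j: "j \<in> {1..p}"
  shows "cell (r j) = j"
proof -
  have "strict_mono_on {1..p} (cell \<circ> r)"
  proof (rule strict_mono_onI)
    fix i j assume ij: "i \<in> {1..p}" "j \<in> {1..p}" "i < j"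
    then have less: "r i < r j"
      using r unfolding level_points_def by (blast dest: strict_mono_onD)
    moreover have "cell (r i) \<noteq> cell (r j)"
      using same_cell_less_iff[of "r i" "r j"] same_cell_less_iff[of "r j" "r i"] less r ij
      by (auto simp: level_points_def)
    ultimately show "(cell \<circ> r) i < (cell \<circ> r) j"
      using cell_mono[of "r i" "r j"] by simp
  qed
  moreover have "(cell \<circ> r) ` {1..p} = {1..p}"
  proof (rule endo_inj_surj)
    show "(cell \<circ> r) ` {1..p} \<subseteq> {1..p}"
      using cell_range by fastforce
    show "inj_on (cell \<circ> r) {1..p}"
      using \<open>strict_mono_on {1..p} (cell \<circ> r)\<close> by (rule strict_mono_on_imp_inj_on)
  qed simp
  ultimately show ?thesis
    using strict_mono_on_atLeastAtMost_onto(2)[of p "cell \<circ> r" p j] j by simp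
qed

lemma level_point_compare:
  assumes r: "level_points c r" and x: "x \<notin> poles" "cell x = j"
  shows "x < r j \<longleftrightarrow> m x < c" and "r j < x \<longleftrightarrow> c < m x"
proof -
  have j: "j \<in> {1..p}"
    using cell_range[of x] x by simp
  then have "cell (r j) = j" "r j \<notin> poles" "m (r j) = c"
    using cell_level_point[OF r j] r by (auto simp: level_points_def)
  then show "x < r j \<longleftrightarrow> m x < c" and "r j < x \<longleftrightarrow> c < m x"
    using same_cell_less_iff x by auto
qed

lemma level_points_less:
  assumes "level_points c r" "level_points d s" "c < d" "j \<in> {1..p}"
  shows "r j < s j"
  using level_point_compare(1)[OF assms(2), of "r j" j] cell_level_point[OF assms(1,4)] assms
  by (auto simp: level_points_def)

text \<open>
  A slope of at least \<open>1\<close> bounds the distance of two levels within a cell by their difference.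
\<close>

lemma level_points_gap:
  assumes r: "level_points c r" and s: "level_points d s" and "c \<le> d" and j: "j \<in> {1..p}"
  shows "s j - r j \<le> d - c"
proof (cases "c < d")
  case True
  then show ?thesis
    using same_cell_slope[of "s j" "r j"] level_points_less[OF r s True j]
      cell_level_point[OF r j] cell_level_point[OF s j] r s j by (auto simp: level_points_def)
next
  case False
  then show ?thesis
    using same_cell_less_iff[of "s j" "r j"] same_cell_less_iff[of "r j" "s j"] assms
      cell_level_point[OF r j] cell_level_point[OF s j] by (auto simp: level_points_def)
qed

lemma level_point_less_pole:
  assumes r: "level_points c r" and j: "j \<in> {1..<p}"
  shows "r j < \<tau> j"
proof -
  have "\<not> \<tau> j < r j"
    using pole_less_iff[OF j, of "r j"] cell_level_point[OF r, of j] j by simp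
  moreover have "r j \<notin> poles"
    using r j by (simp add: level_points_def)
  then have "r j \<noteq> \<tau> j"
    using j by blast
  ultimately show ?thesis
    by simp
qed

lemma pole_less_level_point:
  assumes r: "level_points c r" and j: "j \<in> {1..<p}"
  shows "\<tau> j < r (Suc j)"
  using pole_less_iff[OF j, of "r (Suc j)"] cell_level_point[OF r, of "Suc j"] j by simp

text \<open>
  Inside a cell \<open>m\<close> increases strictly, so it meets a nonincreasing function at most once.
\<close>

lemma crossing_unique:
  assumes x: "x \<notin> poles" "m x = h x" and y: "y \<notin> poles" "m y = h y"
    and eq: "cell x = cell y"
    and anti: "x \<le> y \<Longrightarrow> h y \<le> h x" "y \<le> x \<Longrightarrow> h x \<le> h y"
  shows "x = y"
  using same_cell_less_iff[of x y] same_cell_less_iff[of y x] assms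
  by (cases x y rule: linorder_cases) auto

lemma crossing_exists:
  assumes xy: "x \<le> y" "x \<notin> poles" "y \<notin> poles" "cell x = cell y"
    and h: "continuous_on {x..y} h" "m x \<le> h x" "h y \<le> m y"
  obtains z where "z \<in> {x..y}" "z \<notin> poles" "cell z = cell x" "m z = h z"
proof -
  have none: "{x..y} \<inter> poles = {}"
    using same_cell_no_pole xy by blast
  have "continuous_on {x..y} (\<lambda>z. m z - h z)"
    using cont[OF none] h(1) by (intro continuous_intros)
  then obtain z where z: "x \<le> z" "z \<le> y" "m z - h z = 0"
    using IVT'[of "\<lambda>z. m z - h z" x 0 y] h xy(1) by auto
  moreover have "cell z = cell x"
    using cell_mono[OF z(1)] cell_mono[OF z(2)] xy(4) by simp
  moreover have "z \<notin> poles"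
    using none z(1,2) by (metis IntI atLeastAtMost_iff empty_iff)
  ultimately show thesis
    using that[of z] by simp
qed

text \<open>
  Below \<open>d\<close> the curve \<open>h\<close> decreases through the values between \<open>hi\<close> and \<open>lo\<close>. In a cell with \<open>u j < d\<close>
  it starts above \<open>m\<close> at \<open>u j\<close> and ends below \<open>m\<close> at \<open>min (v j) d\<close>: if \<open>v j \<le> d\<close>, because \<open>m\<close> is already at
  level \<open>hi\<close>; otherwise, because \<open>h\<close> has come down to \<open>lo\<close> while \<open>m\<close> has grown beyond it. In a cell with
  \<open>u j \<ge> d\<close> there is no crossing, as \<open>m \<le> lo < h\<close> throughout the part to the left of \<open>d\<close>. The cells with
  \<open>u j < d\<close> form an initial segment, hence the \<open>j\<close>-th crossing lies in the \<open>j\<close>-th cell.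
\<close>

lemma crossings_below:
  fixes lam :: "nat \<Rightarrow> real"
  assumes lo: "level_points lo u" and hi: "level_points hi v"
    and h_anti: "\<And>x y. x \<le> y \<Longrightarrow> y \<le> d \<Longrightarrow> h y \<le> h x"
    and h_cont: "continuous_on {..d} h"
    and h_end: "h d = lo"
    and h_less: "\<And>x. x < d \<Longrightarrow> lo < h x" "\<And>x. x \<le> d \<Longrightarrow> h x < hi"
    and lam_mono: "strict_mono_on {1..n} lam"
    and lam_im: "lam ` {1..n} = {x. x < d \<and> x \<notin> poles \<and> m x = h x}"
  shows "n = card {j \<in> {1..p}. u j < d}" and "n \<le> p"
    and "\<And>j. j \<in> {1..n} \<Longrightarrow> u j < lam j \<and> lam j < v j \<and> lam j < d"
proof -
  have lamD: "lam j < d" "lam j \<notin> poles" "m (lam j) = h (lam j)" if "j \<in> {1..n}" for j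
    using lam_im that by blast+
  have u_less: "u (cell x) < x" "x < v (cell x)" if "x < d" "x \<notin> poles" "m x = h x" for x
    using level_point_compare[OF lo that(2) refl] level_point_compare[OF hi that(2) refl]
      h_less(1)[of x] h_less(2)[of x] that by auto
  define r where "r = card {j \<in> {1..p}. u j < d}"
  have u_mono: "strict_mono_on {1..p} u"
    using lo by (simp add: level_points_def)
  have down: "{j \<in> {1..p}. u j < d} = {1..r}"
    unfolding r_def
  proof (rule initial_segment_eq)
    fix i j assume j: "j \<in> {j \<in> {1..p}. u j < d}" and i: "1 \<le> i" "i \<le> j"
    then have "u i \<le> u j"
      using strict_mono_onD[OF u_mono, of i j] by (cases "i = j") auto
    then show "i \<in> {j \<in> {1..p}. u j < d}"
      using i j by simp
  qed auto
  have mono: "strict_mono_on {1..n} (cell \<circ> lam)"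
  proof (rule strict_mono_onI)
    fix i j assume ij: "i \<in> {1..n}" "j \<in> {1..n}" "i < j"
    then have less: "lam i < lam j"
      using lam_mono by (blast dest: strict_mono_onD)
    have "cell (lam i) \<noteq> cell (lam j)"
    proof
      assume "cell (lam i) = cell (lam j)"
      then have "lam i = lam j"
        using crossing_unique[of "lam i" h "lam j"] h_anti[of "lam i" "lam j"] lamD[OF ij(1)]
          lamD[OF ij(2)] less by simp
      then show False
        using less by simp
    qed
    then show "(cell \<circ> lam) i < (cell \<circ> lam) j"
      using cell_mono[of "lam i" "lam j"] less by simp
  qed
  have onto: "(cell \<circ> lam) ` {1..n} = {1..r}"
  proof (intro equalityI subsetI)
    fix j assume "j \<in> (cell \<circ> lam) ` {1..n}"
    then obtain i where i: "i \<in> {1..n}" "j = cell (lam i)"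
      by auto
    then have "u j < d"
      using u_less(1)[of "lam i"] lamD[OF i(1)] by simp
    then show "j \<in> {1..r}"
      using down cell_range[of "lam i"] i by blast
  next
    fix j assume "j \<in> {1..r}"
    then have j: "j \<in> {1..p}" "u j < d"
      using down by blast+
    define y where "y = min (v j) d"
    have u: "u j \<notin> poles" "m (u j) = lo" "cell (u j) = j"
      and v: "v j \<notin> poles" "m (v j) = hi" "cell (v j) = j"
      using lo hi j cell_level_point[OF lo j(1)] cell_level_point[OF hi j(1)]
      by (auto simp: level_points_def)
    have "lo < hi"
      using h_end h_less(2)[of d] by simp
    then have uv: "u j < v j"
      using level_points_less[OF lo hi _ j(1)] by simp
    have uy: "u j < y" "y \<le> v j" "y \<le> d"
      using uv j by (auto simp: y_def)
    have celly: "cell y = j"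
      using cell_mono[of "u j" y] cell_mono[of y "v j"] uy u v by simp
    have y: "y \<notin> poles"
    proof -
      have "{u j..v j} \<inter> poles = {}"
        by (rule same_cell_no_pole) (use u v in simp_all)
      moreover have "y \<in> {u j..v j}"
        using uy by simp
      ultimately show ?thesis
        by blast
    qed
    have "h y \<le> m y"
    proof (cases "v j \<le> d")
      case True
      then show ?thesis
        using v(2) h_less(2)[OF uy(3)] by (simp add: y_def)
    next
      case False
      then have "y = d"
        by (simp add: y_def)
      then show ?thesis
        using same_cell_less_iff[OF y u(1)] u(2,3) celly uy(1) h_end by simp
    qed
    moreover have "m (u j) \<le> h (u j)"
      using h_less(1)[of "u j"] j u by simp
    moreover have "continuous_on {u j..y} h"
      by (rule continuous_on_subset[OF h_cont]) (use uy in auto)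
    ultimately obtain z where z: "z \<in> {u j..y}" "z \<notin> poles" "cell z = cell (u j)" "m z = h z"
      using crossing_exists[of "u j" y h] uy u y celly by auto
    \<comment> \<open>The crossing found on the closed interval must be strictly below \<open>d\<close>: at \<open>d\<close> the curve has level
      \<open>lo\<close>, which \<open>m\<close> attains in this cell only at \<open>u j\<close>.\<close>
    have "z \<noteq> d"
    proof
      assume "z = d"
      then have "m z = m (u j)"
        using z(4) h_end u(2) by simp
      then show False
        using same_cell_less_iff[OF z(2) u(1)] z(3) j(2) \<open>z = d\<close> by simp
    qed
    then have "z < d" and cellz: "cell z = j"
      using z(1,3) uy(3) u(3) by simp_all
    then have "z \<in> lam ` {1..n}"
      unfolding lam_im using z(2,4) by simp
    then have "cell z \<in> cell ` lam ` {1..n}"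
      by (rule imageI)
    then show "j \<in> (cell \<circ> lam) ` {1..n}"
      unfolding cellz by (simp add: image_comp)
  qed
  show "n = card {j \<in> {1..p}. u j < d}"
    using strict_mono_on_atLeastAtMost_onto(1)[OF mono onto] by (simp add: r_def)
  moreover have "card {j \<in> {1..p}. u j < d} \<le> card {1..p}"
    by (intro card_mono) auto
  ultimately show "n \<le> p"
    by simp
  show "u j < lam j \<and> lam j < v j \<and> lam j < d" if j: "j \<in> {1..n}" for j
    using u_less[of "lam j"] lamD[OF j] strict_mono_on_atLeastAtMost_onto(2)[OF mono onto j] by simp
qed

lemma reflected_poles: "(\<lambda>i. - \<tau> (p - i)) ` {1..<p} = uminus ` poles"
proof -
  have "(\<lambda>i. p - i) ` {1..<p} = {1..<p}"
  proof (intro equalityI subsetI)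
    fix i assume "i \<in> {1..<p}"
    then show "i \<in> (\<lambda>i. p - i) ` {1..<p}"
      by (intro image_eqI[of _ _ "p - i"]) auto
  qed auto
  then have "uminus ` \<tau> ` (\<lambda>i. p - i) ` {1..<p} = uminus ` poles"
    by simp
  then show ?thesis
    by (simp add: image_image)
qed

text \<open>
  The map \<open>x \<mapsto> - m (- x)\<close> is again increasing between its poles. It exchanges the two half-lines and
  so spares a second proof for the eigenvalues above \<open>2\<close>.
\<close>

lemma reflected_branches: "increasing_branches p (\<lambda>i. - \<tau> (p - i)) (\<lambda>x. - m (- x))"
proof -
  have avoid: "{- y..- x} \<inter> poles = {}" if "{x..y} \<inter> uminus ` poles = {}" for x y
  proof (rule ccontr)
    assume "{- y..- x} \<inter> poles \<noteq> {}"
    then obtain w where w: "w \<in> poles" "w \<in> {- y..- x}"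
      by blast
    then have "- w \<in> {x..y}"
      by simp
    then have "- w \<in> {x..y} \<inter> uminus ` poles"
      using w(1) by blast
    then show False
      using that by blast
  qed
  show ?thesis
  proof
    show "1 \<le> p"
      by (rule p_pos)
    show "strict_mono_on {1..<p} (\<lambda>i. - \<tau> (p - i))"
      by (rule strict_mono_onI) (auto intro!: strict_mono_onD[OF pole_mono])
    fix x y :: real
    assume "{x..y} \<inter> (\<lambda>i. - \<tau> (p - i)) ` {1..<p} = {}"
    then have no_pole: "{- y..- x} \<inter> poles = {}"
      unfolding reflected_poles by (rule avoid)
    show "y - x \<le> - m (- y) - - m (- x)" if "x \<le> y"
      using slope[OF _ no_pole] that by simp
    show "continuous_on {x..y} (\<lambda>x. - m (- x))"
      by (intro continuous_on_minus continuous_on_compose2[OF cont[OF no_pole]] continuous_intros) auto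
  qed
qed

lemma crossings_above:
  fixes lam :: "nat \<Rightarrow> real"
  assumes lo: "level_points lo u" and hi: "level_points hi v"
    and h_anti: "\<And>x y. x \<le> y \<Longrightarrow> d \<le> x \<Longrightarrow> h y \<le> h x"
    and h_cont: "continuous_on {d..} h"
    and h_end: "h d = hi"
    and h_less: "\<And>x. d < x \<Longrightarrow> h x < hi" "\<And>x. d \<le> x \<Longrightarrow> lo < h x"
    and lam_anti: "strict_antimono_on {1..n} lam"
    and lam_im: "lam ` {1..n} = {x. d < x \<and> x \<notin> poles \<and> m x = h x}"
  shows "n = card {j \<in> {1..p}. d < v j}" and "n \<le> p"
    and "\<And>j. j \<in> {1..n} \<Longrightarrow> u (p + 1 - j) < lam j \<and> lam j < v (p + 1 - j) \<and> d < lam j"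
proof -
  \<comment> \<open>Reflection reverses the order of the cells.\<close>
  define \<rho> where "\<rho> j = p + 1 - j" for j
  interpret R: increasing_branches p "\<lambda>i. - \<tau> (p - i)" "\<lambda>x. - m (- x)"
    by (rule reflected_branches)
  have in_poles: "x \<in> R.poles \<longleftrightarrow> - x \<in> poles" for x
    unfolding reflected_poles using image_iff[of x uminus poles] by (metis minus_minus)
  have levels: "R.level_points (- c) (\<lambda>j. - r (\<rho> j))" if "level_points c r" for c r
    unfolding R.level_points_def
  proof (intro conjI ballI)
    show "strict_mono_on {1..p} (\<lambda>j. - r (\<rho> j))"
      using that by (intro strict_mono_onI) (auto simp: level_points_def \<rho>_def intro!: strict_mono_onD[of "{1..p}" r])
  next
    fix j assume "j \<in> {1..p}"
    then have "\<rho> j \<in> {1..p}"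
      by (auto simp: \<rho>_def)
    then show "- r (\<rho> j) \<notin> R.poles" "- m (- (- r (\<rho> j))) = - c"
      using that unfolding in_poles by (simp_all add: level_points_def)
  qed
  have mono': "strict_mono_on {1..n} (\<lambda>j. - lam j)"
    using lam_anti by (auto simp: monotone_on_def)
  have im': "(\<lambda>j. - lam j) ` {1..n} = {x. x < - d \<and> x \<notin> R.poles \<and> - m (- x) = - h (- x)}"
  proof -
    have "x \<in> uminus ` (lam ` {1..n}) \<longleftrightarrow> - x \<in> lam ` {1..n}" for x
      using image_iff[of x uminus "lam ` {1..n}"] by (metis minus_minus)
    moreover have "(\<lambda>j. - lam j) ` {1..n} = uminus ` (lam ` {1..n})"
      by (simp add: image_image)
    ultimately have "x \<in> (\<lambda>j. - lam j) ` {1..n} \<longleftrightarrow> d < - x \<and> - x \<notin> poles \<and> m (- x) = h (- x)" for x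
      unfolding lam_im by simp
    then show ?thesis
      unfolding in_poles set_eq_iff mem_Collect_eq by (simp add: less_minus_iff)
  qed
  have cont': "continuous_on {..- d} (\<lambda>x. - h (- x))"
    by (intro continuous_on_minus continuous_on_compose2[OF h_cont] continuous_intros) auto
  have below: "n = card {j \<in> {1..p}. - v (\<rho> j) < - d}" "n \<le> p"
    "\<And>j. j \<in> {1..n} \<Longrightarrow> - v (\<rho> j) < - lam j \<and> - lam j < - u (\<rho> j) \<and> - lam j < - d"
    using R.crossings_below[OF levels[OF hi] levels[OF lo], of "- d" "\<lambda>x. - h (- x)" n "\<lambda>j. - lam j"]
      h_anti cont' h_end h_less mono' im' by simp_all
  have "bij_betw \<rho> {j \<in> {1..p}. - v (\<rho> j) < - d} {j \<in> {1..p}. d < v j}"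
    by (rule bij_betw_byWitness[where f' = \<rho>]) (auto simp: \<rho>_def)
  then show "n = card {j \<in> {1..p}. d < v j}"
    using below(1) by (simp add: bij_betw_same_card)
  show "n \<le> p"
    by (rule below(2))
  show "u (p + 1 - j) < lam j \<and> lam j < v (p + 1 - j) \<and> d < lam j" if "j \<in> {1..n}" for j
    using below(3)[OF that] by (simp add: \<rho>_def)
qed

end

section \<open>The Jost polynomial\<close>

text \<open>
  The discrete analogue of the constancy of the Wronskian for two solutions of the same
  second-order equation.
\<close>

lemma casoratian_constant:
  fixes u v :: "nat \<Rightarrow> 'a::real_normed_field"
  assumes u: "\<And>x. 1 \<le> x \<Longrightarrow>
      of_real (a (x - 1)) * u (x - 1) + of_real (b x) * u x + of_real (a x) * u (Suc x) = e * u x"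
    and v: "\<And>x. 1 \<le> x \<Longrightarrow>
      of_real (a (x - 1)) * v (x - 1) + of_real (b x) * v x + of_real (a x) * v (Suc x) = e * v x"
  shows "of_real (a x) * (u x * v (Suc x) - u (Suc x) * v x) = of_real (a 0) * (u 0 * v 1 - u 1 * v 0)"
proof (induction x)
  case (Suc x)
  have "of_real (a (Suc x)) * v (Suc (Suc x)) = (e - of_real (b (Suc x))) * v (Suc x) - of_real (a x) * v x"
    and "of_real (a (Suc x)) * u (Suc (Suc x)) = (e - of_real (b (Suc x))) * u (Suc x) - of_real (a x) * u x"
    using v[of "Suc x"] u[of "Suc x"] by (simp_all add: algebra_simps)
  note steps = this
  have "of_real (a (Suc x)) * (u (Suc x) * v (Suc (Suc x)) - u (Suc (Suc x)) * v (Suc x))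
      = u (Suc x) * (of_real (a (Suc x)) * v (Suc (Suc x))) - of_real (a (Suc x)) * u (Suc (Suc x)) * v (Suc x)"
    by (simp add: algebra_simps)
  also have "\<dots> = of_real (a x) * (u x * v (Suc x) - u (Suc x) * v x)"
    unfolding steps by (simp add: algebra_simps)
  finally show ?case
    using Suc by simp
qed simp

text \<open>
  This is \<open>D\<^sub>n(z + 1/z)\<close> multiplied by \<open>z\<^sup>n\<close> to clear the negative powers, with the same shift of the
  index as in \<open>jacobi_poly\<close>. Its coefficients read the same in both directions.
\<close>

fun palindromic_poly ::
  "(nat \<Rightarrow> real) \<Rightarrow> (nat \<Rightarrow> real) \<Rightarrow> nat \<Rightarrow> 'a::real_normed_field poly" where
  "palindromic_poly a b 0 = 0"
| "palindromic_poly a b (Suc 0) = 1"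
| "palindromic_poly a b (Suc (Suc n)) =
     [:1, - of_real (b (Suc n)), 1:] * palindromic_poly a b (Suc n)
     - Polynomial.smult (of_real ((a n)\<^sup>2)) (pCons 0 (pCons 0 (palindromic_poly a b n)))"

lemma poly_palindromic_poly_of_real:
  "poly (palindromic_poly a b n) (of_real x :: 'a::real_normed_field) =
     of_real (poly (palindromic_poly a b n) x)"
  by (induction a b n rule: palindromic_poly.induct) (auto simp: algebra_simps)

lemma poly_palindromic_poly:
  assumes "z \<noteq> 0"
  shows "z ^ n * poly (jacobi_poly a b n) (z + inverse z) = z * poly (palindromic_poly a b n) z"
proof (induction a b n rule: jacobi_poly.induct[case_names 0 1 SS])
  case (SS a b n)
  let ?D = "\<lambda>n. poly (jacobi_poly a b n) (z + inverse z)" and ?P = "\<lambda>n. poly (palindromic_poly a b n) z"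
  have "z ^ Suc (Suc n) * ?D (Suc (Suc n)) =
      (z * (z + inverse z - of_real (b (Suc n)))) * (z ^ Suc n * ?D (Suc n)) - of_real ((a n)\<^sup>2) * z\<^sup>2 * (z ^ n * ?D n)"
    by (simp add: algebra_simps power2_eq_square)
  also have "z * (z + inverse z - of_real (b (Suc n))) = 1 - of_real (b (Suc n)) * z + z\<^sup>2"
    using assms by (simp add: algebra_simps power2_eq_square)
  finally show ?case
    unfolding SS.IH by (simp add: algebra_simps power2_eq_square)
qed auto

text \<open>
  Each step multiplies by a monic quadratic polynomial and subtracts a polynomial of smaller
  degree, so the leading coefficient stays \<open>1\<close>.
\<close>

lemma coeff_palindromic_poly:
  "coeff (palindromic_poly a b (Suc n)) (2 * n) = (1 :: 'a::real_normed_field) \<and>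
     (\<forall>j>2 * n. coeff (palindromic_poly a b (Suc n)) j = (0 :: 'a))"
proof (induction n rule: less_induct)
  case (less n)
  show ?case
  proof (cases n)
    case (Suc m)
    let ?P = "palindromic_poly a b :: nat \<Rightarrow> 'a poly"
    have vanish: "coeff (?P m) i = 0" if "2 * m \<le> i + 1" for i
    proof (cases m)
      case (Suc l)
      then show ?thesis
        using less.IH[of l] \<open>n = Suc m\<close> that by auto
    qed simp
    have rec: "coeff (?P (Suc n)) (Suc (Suc i)) = coeff (?P n) (Suc (Suc i)) - of_real (b n) * coeff (?P n) (Suc i)
        + coeff (?P n) i - of_real ((a m)\<^sup>2) * coeff (?P m) i" for i
      by (simp add: Suc algebra_simps)
    have IH: "coeff (?P n) (2 * m) = 1" "coeff (?P n) j = 0" if "2 * m < j" for j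
      using less.IH[of m] Suc that by auto
    have "coeff (?P n) (2 * m) = 1"
      using less.IH[of m] Suc by auto
    moreover have "coeff (?P (Suc n)) j = 0" if j: "2 * n < j" for j
    proof -
      obtain i where "j = Suc (Suc i)" "2 * m < i"
        using j Suc by (metis Suc_less_eq less_imp_Suc_add mult_Suc_right numeral_2_eq_2 add_2_eq_Suc add_Suc_right)
      then show ?thesis
        using rec[of i] IH vanish[of i] by simp
    qed
    ultimately show ?thesis
      using rec[of "2 * m"] IH(2) vanish[of "2 * m"] Suc by simp
  qed (auto simp: one_pCons coeff_pCons split: nat.splits)
qed

text \<open>
  The Jost function without its constant factor, in the form \<open>z\<^sup>p (D\<^sub>p - a\<^sub>p\<^sup>2 z D\<^sub>p\<^sub>-\<^sub>1)(z + 1/z)\<close>;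
  see \<open>poly_jost_poly\<close> and \<open>jost_function_eq\<close>.
\<close>

definition jost_poly ::
  "(nat \<Rightarrow> real) \<Rightarrow> (nat \<Rightarrow> real) \<Rightarrow> nat \<Rightarrow> 'a::real_normed_field poly" where
  "jost_poly a b p = palindromic_poly a b (Suc p)
     - Polynomial.smult (of_real ((a p)\<^sup>2)) (pCons 0 (pCons 0 (palindromic_poly a b p)))"

lemma poly_jost_poly_of_real:
  "poly (jost_poly a b p) (of_real x :: 'a::real_normed_field) = of_real (poly (jost_poly a b p) x)"
  by (simp add: jost_poly_def poly_palindromic_poly_of_real)

lemma poly_pderiv_jost_poly_of_real:
  "poly (pderiv (jost_poly a b p)) (of_real x :: 'a::real_normed_field) =
     of_real (poly (pderiv (jost_poly a b p)) x)"
proof -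
  have "poly (pderiv (palindromic_poly a b n)) (of_real x :: 'a) =
      of_real (poly (pderiv (palindromic_poly a b n)) x)" for n
    by (induction a b n rule: palindromic_poly.induct)
      (auto simp: pderiv_mult pderiv_diff pderiv_add pderiv_smult pderiv_pCons
        poly_palindromic_poly_of_real algebra_simps)
  then show ?thesis
    by (simp add: jost_poly_def pderiv_diff pderiv_smult pderiv_pCons
        poly_palindromic_poly_of_real del: palindromic_poly.simps)
qed

lemma poly_jost_poly:
  assumes "z \<noteq> 0"
  shows "poly (jost_poly a b p) z = z ^ p *
    (poly (jacobi_poly a b (Suc p)) (z + inverse z)
      - of_real ((a p)\<^sup>2) * z * poly (jacobi_poly a b p) (z + inverse z))"
proof -
  let ?D = "\<lambda>n. poly (jacobi_poly a b n) (z + inverse z)" and ?P = "\<lambda>n. poly (palindromic_poly a b n) z"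
  have "z * poly (jost_poly a b p) z = z * ?P (Suc p) - of_real ((a p)\<^sup>2) * z\<^sup>2 * (z * ?P p)"
    by (simp add: jost_poly_def algebra_simps power2_eq_square)
  also have "\<dots> = z * (z ^ p * (?D (Suc p) - of_real ((a p)\<^sup>2) * z * ?D p))"
    unfolding poly_palindromic_poly[OF assms, symmetric] by (simp add: algebra_simps power2_eq_square)
  finally show ?thesis
    using assms by simp
qed

lemma poly_jost_poly_0: "poly (jost_poly a b p) 0 = 1"
proof -
  have "poly (palindromic_poly a b (Suc p)) 0 = (1 :: 'a)"
    by (induction p) auto
  then show ?thesis
    by (simp add: jost_poly_def)
qed

text \<open>
  The coefficient of \<open>z\<^sup>2\<^sup>p\<close> is \<open>1 - a\<^sub>p\<^sup>2\<close>. If \<open>a\<^sub>p = 1\<close>, the last step of the recurrence turns the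
  polynomial into \<open>(1 - b\<^sub>p z) P\<close> minus terms of smaller degree, where \<open>P\<close> is monic of degree \<open>2p - 2\<close>;
  so \<open>- b\<^sub>p\<close> is the coefficient of \<open>z\<^sup>2\<^sup>p\<^sup>-\<^sup>1\<close>.
\<close>

lemma degree_jost_poly_ge:
  assumes p: "1 \<le> p" and pos: "0 < a p"
    and k: "k = 2 * p \<and> a p \<noteq> 1 \<or> k = 2 * p - 1 \<and> a p = 1 \<and> b p \<noteq> 0"
  shows "k \<le> degree (jost_poly a b p :: 'a::real_normed_field poly)"
proof (rule le_degree)
  let ?P = "palindromic_poly a b :: nat \<Rightarrow> 'a poly"
  obtain m where m: "p = Suc m"
    using p by (cases p) auto
  have top: "coeff (?P (Suc p)) (2 * p) = 1" "coeff (?P p) (2 * m) = 1"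
    using coeff_palindromic_poly[of a b p] coeff_palindromic_poly[of a b m] m by auto
  have above: "coeff (?P p) j = 0" if "2 * m < j" for j
    using coeff_palindromic_poly[of a b m] m that by auto
  show "coeff (jost_poly a b p :: 'a poly) k \<noteq> 0"
    using k
  proof
    assume *: "k = 2 * p \<and> a p \<noteq> 1"
    have "of_real ((a p)\<^sup>2) \<noteq> (1 :: 'a)"
      using * pos by (metis less_eq_real_def of_real_eq_1_iff power2_eq_1_iff not_one_le_zero neg_0_less_iff_less less_asym zero_less_one)
    then show ?thesis
      using * top m by (simp add: jost_poly_def del: palindromic_poly.simps)
  next
    assume *: "k = 2 * p - 1 \<and> a p = 1 \<and> b p \<noteq> 0"
    have low: "coeff (?P m) j = 0" if "2 * m \<le> j + 1" for j
      using coeff_palindromic_poly[of a b "m - 1"] that by (cases m) (auto simp: Suc_le_eq)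
    have "coeff (jost_poly a b p :: 'a poly) (Suc (2 * m)) = - of_real (b p)"
      using * top above[of "Suc (2 * m)"] low
      by (cases m) (simp_all add: jost_poly_def m)
    then show ?thesis
      using * m by simp
  qed
qed

text \<open>
  Put \<open>F(z) = D\<^sub>p - A z D\<^sub>p\<^sub>-\<^sub>1\<close> at \<open>x = z + 1/z\<close>. Where \<open>F = 0\<close>, multiplying \<open>F'\<close> by \<open>D\<^sub>p\<^sub>-\<^sub>1\<close> gives
  \<open>(1 - 1/z\<^sup>2) W - A D\<^sub>p\<^sub>-\<^sub>1\<^sup>2\<close> with the Wronskian \<open>W > 0\<close>. For real \<open>|z| < 1\<close> this is negative.
\<close>

lemma jost_poly_simple_root:
  fixes r :: real
  assumes pos: "\<And>n. 0 < a n" and r: "r \<noteq> 0" "\<bar>r\<bar> < 1" and root: "poly (jost_poly a b p) r = 0"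
  shows "poly (pderiv (jost_poly a b p)) r \<noteq> 0"
proof -
  define x where "x = r + inverse r"
  define f g f' g' where "f = poly (jacobi_poly a b (Suc p)) x" and "g = poly (jacobi_poly a b p) x"
    and "f' = poly (pderiv (jacobi_poly a b (Suc p))) x" and "g' = poly (pderiv (jacobi_poly a b p)) x"
  let ?A = "(a p)\<^sup>2"
  define F where "F z = poly (jacobi_poly a b (Suc p)) (z + inverse z)
    - ?A * z * poly (jacobi_poly a b p) (z + inverse z)" for z
  define F' where "F' = f' * (1 - inverse (r\<^sup>2)) - ?A * (g + r * (g' * (1 - inverse (r\<^sup>2))))"
  have inner: "((\<lambda>z. z + inverse z) has_field_derivative (1 - inverse (r\<^sup>2))) (at r)"
    by (rule derivative_eq_intros refl r)+ (simp add: power2_eq_square)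
  have "(F has_field_derivative F') (at r)"
    unfolding F_def F'_def f'_def g_def g'_def x_def
    by (rule derivative_eq_intros refl DERIV_chain2[OF poly_DERIV inner])+ (simp add: algebra_simps)
  then have "((\<lambda>z. z ^ p * F z) has_field_derivative (r ^ p * F' + p * r ^ (p - 1) * F r)) (at r)"
    by (auto intro!: derivative_eq_intros)
  moreover have Q: "poly (jost_poly a b p) z = z ^ p * F z" if "z \<noteq> 0" for z
    using poly_jost_poly[OF that, of a b p] by (simp add: F_def)
  have "eventually (\<lambda>z. poly (jost_poly a b p) z = z ^ p * F z) (nhds r)"
    using t1_space_nhds[OF r(1)] by eventually_elim (rule Q)
  ultimately have "(poly (jost_poly a b p) has_field_derivative (r ^ p * F' + p * r ^ (p - 1) * F r)) (at r)"
    using DERIV_cong_ev[OF refl, of "poly (jost_poly a b p)" "\<lambda>z. z ^ p * F z" r, OF _ refl] by simp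
  moreover have Fr: "F r = 0"
    using Q[OF r(1)] root r by simp
  ultimately have deriv: "poly (pderiv (jost_poly a b p)) r = r ^ p * F'"
    using DERIV_unique[OF poly_DERIV] by fastforce
  have f: "f = ?A * r * g"
    using Fr by (simp add: F_def f_def g_def x_def)
  have "g \<noteq> 0"
    using jacobi_poly_no_common_root[of a b p x, OF pos] f by (auto simp: f_def g_def)
  have "g\<^sup>2 \<le> f' * g - f * g'"
    using jacobi_poly_wronskian_ge[of a b p x] by (simp add: f_def g_def f'_def g'_def)
  then have W: "0 < f' * g - f * g'"
    using \<open>g \<noteq> 0\<close> zero_less_power2[of g] by linarith
  have "1 < inverse (r\<^sup>2)"
    using r by (simp add: one_less_inverse_iff power2_eq_square abs_square_less_1 flip: power2_eq_square)
  then have "(1 - inverse (r\<^sup>2)) * (f' * g - f * g') < 0"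
    using W by (simp add: mult_neg_pos)
  moreover have "0 \<le> ?A * g\<^sup>2"
    by simp
  moreover have "g * F' = (1 - inverse (r\<^sup>2)) * (f' * g - f * g') - ?A * g\<^sup>2"
    unfolding F'_def f by (simp add: algebra_simps power2_eq_square)
  ultimately have "g * F' < 0"
    by linarith
  then have "F' \<noteq> 0"
    by auto
  then show ?thesis
    using deriv r by simp
qed

section \<open>The Jost function, eigenvalues and resonances\<close>

lemma jost_solution_recurrence:
  assumes "jost_solution a b p \<psi>" "z \<noteq> 0" "1 \<le> x"
  shows "of_real (a (x - 1)) * \<psi> (x - 1) z + of_real (b x) * \<psi> x z + of_real (a x) * \<psi> (Suc x) z
    = (z + inverse z) * \<psi> x z"
  using assms unfolding jost_solution_def by (simp add: algebra_simps)

text \<open>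
  The Casoratian of the Jost solution and the polynomial solution is evaluated at \<open>0\<close>, where it is
  \<open>- \<psi>\<^sub>0\<close>, and at \<open>p\<close>, where the Jost solution is known: the equation at \<open>p + 1\<close> yields \<open>a\<^sub>p \<psi>\<^sub>p = z\<^sup>p\<close>.
\<close>

lemma jost_function_eq:
  assumes pos: "\<And>n. 0 < a n" and free: "\<And>x. p < x \<Longrightarrow> a x = 1 \<and> b x = 0"
    and jost: "jost_solution a b p \<psi>" and z: "z \<noteq> 0"
  shows "(\<Prod>i\<le>p. of_real (a i)) * \<psi> 0 z = poly (jost_poly a b p) z"
proof -
  let ?e = "z + inverse z" and ?c = "\<lambda>n. \<Prod>i<n. of_real (a i) :: complex"
  let ?D = "\<lambda>n. poly (jacobi_poly a b n) ?e"
  define \<phi> where "\<phi> x = ?D x / ?c x" for x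
  have tail: "\<psi> x z = z ^ x" if "p < x" for x
    using jost that z by (simp add: jost_solution_def)
  have nz: "of_real (a i) \<noteq> (0 :: complex)" for i
    using pos[of i] by simp
  have c: "?c n \<noteq> 0" for n
    using nz by simp
  have "of_real (a p) * \<psi> p z + z ^ (p + 2) = ?e * z ^ (p + 1)"
    using jost_solution_recurrence[OF jost z, of "Suc p"] free[of "Suc p"] tail[of "Suc p"]
      tail[of "Suc (Suc p)"] by simp
  then have \<psi>p: "of_real (a p) * \<psi> p z = z ^ p"
    using z by (simp add: algebra_simps)
  have "of_real (a p) * (\<phi> p * \<psi> (Suc p) z - \<phi> (Suc p) * \<psi> p z) = of_real (a 0) * (\<phi> 0 * \<psi> 1 z - \<phi> 1 * \<psi> 0 z)"
    by (rule casoratian_constant[where b = b and e = ?e, of a \<phi> "\<lambda>x. \<psi> x z"])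
      (use jacobi_poly_solution[of a _ b ?e, OF pos] jost_solution_recurrence[OF jost z] in \<open>auto simp: \<phi>_def\<close>)
  also have "\<dots> = - \<psi> 0 z"
    using nz[of 0] by (simp add: \<phi>_def)
  finally have "\<psi> 0 z = \<phi> (Suc p) * (of_real (a p) * \<psi> p z) - of_real (a p) * \<phi> p * \<psi> (Suc p) z"
    by (simp add: algebra_simps)
  also have "\<dots> = z ^ p * (\<phi> (Suc p) - of_real (a p) * z * \<phi> p)"
    using tail[of "Suc p"] \<psi>p by (simp add: algebra_simps)
  finally have "?c (Suc p) * \<psi> 0 z = ?c (Suc p) * (z ^ p * (\<phi> (Suc p) - of_real (a p) * z * \<phi> p))"
    by (rule arg_cong)
  also have "\<dots> = z ^ p * (?c (Suc p) * \<phi> (Suc p) - of_real (a p) * z * (?c (Suc p) * \<phi> p))"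
    by (simp add: algebra_simps)
  also have "?c (Suc p) * \<phi> (Suc p) = ?D (Suc p)"
    using c[of "Suc p"] by (simp add: \<phi>_def)
  also have "?c (Suc p) * \<phi> p = of_real (a p) * ?D p"
    using c[of p] by (simp add: \<phi>_def)
  finally show ?thesis
    unfolding poly_jost_poly[OF z] lessThan_Suc_atMost
    by (simp add: algebra_simps power2_eq_square)
qed

text \<open>
  If \<open>\<psi>\<^sub>0 = 0\<close>, the Jost solution itself is an eigenfunction, as it decays geometrically. Conversely, the
  Casoratian of an eigenfunction and the Jost solution is constant and tends to \<open>0\<close>; at the origin it
  equals \<open>- a\<^sub>0 f\<^sub>1 \<psi>\<^sub>0\<close>, and \<open>f\<^sub>1 = 0\<close> would make \<open>f\<close> vanish identically.
\<close>

lemma jacobi_eigenvalue_iff_jost_function_zero: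
  assumes pos: "\<And>n. 0 < a n" and free: "\<And>x. p < x \<Longrightarrow> a x = 1 \<and> b x = 0"
    and jost: "jost_solution a b p \<psi>" and z: "z \<noteq> 0" "cmod z < 1"
  shows "jacobi_eigenvalue a b (z + inverse z) \<longleftrightarrow> \<psi> 0 z = 0"
proof -
  let ?e = "z + inverse z"
  have tail: "\<psi> x z = z ^ x" if "p < x" for x
    using jost that z by (simp add: jost_solution_def)
  note \<psi>_rec = jost_solution_recurrence[OF jost z(1)]
  show ?thesis
  proof
    assume zero: "\<psi> 0 z = 0"
    have "summable (\<lambda>x. (cmod z ^ 2) ^ x)"
      using z by (intro summable_geometric) (simp add: abs_square_less_1)
    moreover have "\<forall>\<^sub>F x in sequentially. norm ((cmod (\<psi> x z))\<^sup>2) \<le> (cmod z ^ 2) ^ x"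
      using eventually_gt_at_top[of p]
      by eventually_elim (simp add: tail norm_power power_mult[symmetric] mult.commute)
    ultimately have "summable (\<lambda>x. (cmod (\<psi> x z))\<^sup>2)"
      by (rule summable_comparison_test_ev[rotated])
    then have "(\<lambda>x. \<psi> x z) \<in> ell2"
      using zero by (simp add: ell2_def)
    moreover have "(\<lambda>x. \<psi> x z) \<noteq> (\<lambda>_. 0)"
      using tail[of "Suc p"] z(1) by (auto dest: fun_cong[of _ _ "Suc p"])
    moreover have "jacobi_op a b (\<lambda>x. \<psi> x z) = (\<lambda>x. ?e * \<psi> x z)"
      using \<psi>_rec zero by (auto simp: jacobi_op_def fun_eq_iff algebra_simps)
    ultimately show "jacobi_eigenvalue a b ?e"
      unfolding jacobi_eigenvalue_def by blast
  next
    assume "jacobi_eigenvalue a b ?e"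
    then obtain f where f: "f \<in> ell2" "f \<noteq> (\<lambda>_. 0)" "jacobi_op a b f = (\<lambda>x. ?e * f x)"
      by (auto simp: jacobi_eigenvalue_def)
    have rec: "of_real (a (x - 1)) * f (x - 1) + of_real (b x) * f x + of_real (a x) * f (Suc x) = ?e * f x"
      if "1 \<le> x" for x
      using fun_cong[OF f(3), of x] that by (simp add: jacobi_op_def algebra_simps)
    have f0: "f 0 = 0"
      using f(1) by (simp add: ell2_def)
    have "f 1 \<noteq> 0"
    proof
      assume f1: "f 1 = 0"
      have "f x = 0" for x
      proof -
        have "(\<Prod>i<x. of_real (a i)) * f x = of_real (a 0) * f 1 * poly (jacobi_poly a b x) ?e"
          by (rule recurrence_solution_eq[where u = f and n = x, OF f0]) (use rec in auto)
        moreover have "of_real (a i) \<noteq> (0 :: complex)" for i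
          using pos[of i] by simp
        ultimately show ?thesis
          using f1 by simp
      qed
      then show False
        using f(2) by auto
    qed
    have "(\<lambda>x. (cmod (f x))\<^sup>2) \<longlonglongrightarrow> 0"
      using f(1) by (intro summable_LIMSEQ_zero) (simp add: ell2_def)
    then have "(\<lambda>x. sqrt ((cmod (f x))\<^sup>2)) \<longlonglongrightarrow> sqrt 0"
      by (rule tendsto_real_sqrt)
    then have f_lim: "f \<longlonglongrightarrow> 0"
      by (simp add: tendsto_norm_zero_iff)
    have z_lim: "(\<lambda>x. z ^ x) \<longlonglongrightarrow> 0"
      using z(2) by (rule LIMSEQ_power_zero)
    have "(\<lambda>x. f x * z ^ Suc x - f (Suc x) * z ^ x) \<longlonglongrightarrow> 0 * 0 - 0 * 0"
      by (intro tendsto_intros f_lim z_lim LIMSEQ_Suc[OF z_lim] LIMSEQ_Suc[OF f_lim])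
    moreover have "\<forall>\<^sub>F x in sequentially. f x * z ^ Suc x - f (Suc x) * z ^ x = of_real (a 0) * (f 0 * \<psi> 1 z - f 1 * \<psi> 0 z)"
      using eventually_gt_at_top[of p]
    proof eventually_elim
      case (elim x)
      then show ?case
        using casoratian_constant[of a f b ?e "\<lambda>x. \<psi> x z" x, OF rec \<psi>_rec] free[of x]
          tail[of x] tail[of "Suc x"] by simp
    qed
    ultimately have "(\<lambda>x::nat. of_real (a 0) * (f 0 * \<psi> 1 z - f 1 * \<psi> 0 z)) \<longlonglongrightarrow> 0"
      using tendsto_cong by force
    then have "of_real (a 0) * (f 0 * \<psi> 1 z - f 1 * \<psi> 0 z) = 0"
      by (simp add: LIMSEQ_const_iff)
    then show "\<psi> 0 z = 0"
      using f0 \<open>f 1 \<noteq> 0\<close> pos[of 0] by simp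
  qed
qed

text \<open>
  Both multiplicities are exponents of \<open>w - z\<close> in a factorisation with a nonvanishing cofactor on a
  punctured neighbourhood of \<open>z\<close>.
\<close>

lemma zorder_eq_order:
  assumes Q: "Q \<noteq> 0" and ev: "\<forall>\<^sub>F w in at z. c * F w = poly Q w" and c: "c \<noteq> 0"
  shows "zorder F z = int (Polynomial.order z Q)"
proof -
  obtain R where R: "Q = [:- z, 1:] ^ Polynomial.order z Q * R" "\<not> [:- z, 1:] dvd R"
    using order_decomp[OF Q] by blast
  obtain S where S: "open S" "z \<in> S" "\<And>w. w \<in> S \<Longrightarrow> w \<noteq> z \<Longrightarrow> c * F w = poly Q w"
    using ev unfolding eventually_at_topological by blast
  show ?thesis
  proof (rule zorder_eqI[OF S(1,2)])
    show "(\<lambda>w. poly R w / c) holomorphic_on S"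
      using c by (intro holomorphic_intros)
    show "poly R z / c \<noteq> 0"
      using R(2) c by (simp add: poly_eq_0_iff_dvd)
    fix w assume w: "w \<in> S" "w \<noteq> z"
    have "c * F w = poly R w * (w - z) ^ Polynomial.order z Q"
      unfolding S(3)[OF w] by (subst R(1)) (simp add: mult.commute)
    then show "F w = poly R w / c * (w - z) powi int (Polynomial.order z Q)"
      using c by (simp add: field_simps)
  qed
qed

lemma sum_order_eq_degree:
  fixes Q :: "complex poly"
  assumes "Q \<noteq> 0"
  shows "(\<Sum>z | poly Q z = 0. Polynomial.order z Q) = degree Q"
  using size_proots_complex[of Q] assms by (simp add: size_multiset_overloaded_eq)

text \<open>
  The zeros counted with multiplicity add up to the degree, and those in the open disc contribute
  one each. The identity \<open>c F = Q\<close> is asked for only away from \<open>0\<close>, where the Jost solution is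
  determined.
\<close>

lemma resonance_count_ge:
  fixes Q :: "complex poly"
  assumes Q0: "poly Q 0 \<noteq> 0" and c: "c \<noteq> 0" and F: "\<And>z. z \<noteq> 0 \<Longrightarrow> c * F z = poly Q z"
    and simple: "\<And>z. cmod z < 1 \<Longrightarrow> poly Q z = 0 \<Longrightarrow> poly (pderiv Q) z \<noteq> 0"
  shows "degree Q \<le> resonance_count F + card {z. cmod z < 1 \<and> poly Q z = 0}"
proof -
  let ?ord = "\<lambda>z. Polynomial.order z Q"
  have Q: "Q \<noteq> 0"
    using Q0 by auto
  have fin: "finite {z. poly Q z = 0}"
    by (rule poly_roots_finite[OF Q])
  have split: "{z. poly Q z = 0} = {z. 1 \<le> cmod z \<and> poly Q z = 0} \<union> {z. cmod z < 1 \<and> poly Q z = 0}"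
    by auto
  have res: "resonances F = {z. 1 \<le> cmod z \<and> poly Q z = 0}"
  proof -
    have "F z = 0 \<longleftrightarrow> poly Q z = 0" if "1 \<le> cmod z" for z
      using F[of z] c that by (cases "z = 0") auto
    then show ?thesis
      unfolding resonances_def by blast
  qed
  have "zorder F z = int (?ord z)" if "1 \<le> cmod z" for z
  proof (rule zorder_eq_order[OF Q _ c])
    have "z \<noteq> 0"
      using that by auto
    then have "\<forall>\<^sub>F w in nhds z. w \<noteq> 0"
      by (rule t1_space_nhds)
    then have "\<forall>\<^sub>F w in nhds z. c * F w = poly Q w"
      by eventually_elim (rule F)
    then show "\<forall>\<^sub>F w in at z. c * F w = poly Q w"
      by (simp add: eventually_nhds_conv_at)
  qed
  then have "resonance_count F = (\<Sum>z | 1 \<le> cmod z \<and> poly Q z = 0. ?ord z)"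
    unfolding resonance_count_def res by (intro sum.cong) auto
  moreover have "(\<Sum>z | cmod z < 1 \<and> poly Q z = 0. ?ord z) = (\<Sum>z | cmod z < 1 \<and> poly Q z = 0. 1)"
  proof (rule sum.cong[OF refl])
    fix z assume z: "z \<in> {z. cmod z < 1 \<and> poly Q z = 0}"
    then have "poly (pderiv Q) z \<noteq> 0" "poly Q z = 0"
      using simple[of z] by auto
    then show "?ord z = 1"
      using order_pderiv[of Q z] order_0I[of "pderiv Q" z] Q by simp
  qed
  moreover have "degree Q = (\<Sum>z | 1 \<le> cmod z \<and> poly Q z = 0. ?ord z) + (\<Sum>z | cmod z < 1 \<and> poly Q z = 0. ?ord z)"
    unfolding sum_order_eq_degree[OF Q, symmetric] split
    by (rule sum.union_disjoint) (use fin in \<open>auto intro: finite_subset[rotated]\<close>)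
  ultimately show ?thesis
    by simp
qed

section \<open>The spectral parameter inside the unit disc\<close>

text \<open>
  The solution \<open>z\<close> of \<open>z + 1/z = x\<close> with \<open>|z| \<le> 1\<close>, for \<open>|x| \<ge> 2\<close>. Rationalising the numerator of the
  usual formula makes monotonicity visible: the denominator grows in absolute value with \<open>|x|\<close>.
\<close>

definition joukowski_inverse :: "real \<Rightarrow> real" where
  "joukowski_inverse x = 2 / (x + sgn x * sqrt (x\<^sup>2 - 4))"

lemma joukowski_inverse_minus: "joukowski_inverse (- x) = - joukowski_inverse x"
proof -
  have "- x + sgn (- x) * sqrt ((- x)\<^sup>2 - 4) = - (x + sgn x * sqrt (x\<^sup>2 - 4))"
    by (simp add: sgn_minus)
  then show ?thesis
    unfolding joukowski_inverse_def by (simp only: divide_minus_right)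
qed

lemma joukowski_inverse_pos:
  assumes "2 \<le> x"
  shows "joukowski_inverse x = 2 / (x + sqrt (x\<^sup>2 - 4))" "0 < joukowski_inverse x" "joukowski_inverse x \<le> 1"
    "2 < x \<Longrightarrow> joukowski_inverse x < 1" "joukowski_inverse x + inverse (joukowski_inverse x) = x"
proof -
  have sq: "4 \<le> x\<^sup>2"
    using power_mono[OF assms, of 2] by simp
  define t where "t = sqrt (x\<^sup>2 - 4)"
  have t: "0 \<le> t" "t\<^sup>2 = x\<^sup>2 - 4"
    using sq by (simp_all add: t_def)
  show eq: "joukowski_inverse x = 2 / (x + sqrt (x\<^sup>2 - 4))"
    using assms by (simp add: joukowski_inverse_def)
  show "0 < joukowski_inverse x" "joukowski_inverse x \<le> 1" "2 < x \<Longrightarrow> joukowski_inverse x < 1"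
    unfolding eq using t(1) assms by (simp_all add: t_def[symmetric] divide_simps)
  have "4 + (x + t)\<^sup>2 = 2 * x * (x + t)"
    using t(2) by (simp add: power2_eq_square algebra_simps)
  then show "joukowski_inverse x + inverse (joukowski_inverse x) = x"
    unfolding eq t_def[symmetric] using t(1) assms
    by (simp add: field_simps power2_eq_square)
qed

lemma joukowski_inverse_neg:
  assumes "x \<le> - 2"
  shows "joukowski_inverse x < 0" "- 1 \<le> joukowski_inverse x" "x < - 2 \<Longrightarrow> - 1 < joukowski_inverse x"
  using joukowski_inverse_pos(2-4)[of "- x"] assms by (simp_all add: joukowski_inverse_minus)

lemma joukowski_inverse_ends: "joukowski_inverse 2 = 1" "joukowski_inverse (- 2) = - 1"
  by (simp_all add: joukowski_inverse_def)

lemma joukowski_inverse_antimono: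
  assumes "x \<le> y" "2 \<le> x \<or> y \<le> - 2"
  shows "joukowski_inverse y \<le> joukowski_inverse x"
proof -
  have *: "joukowski_inverse y \<le> joukowski_inverse x" if "2 \<le> x" "x \<le> y" for x y
  proof -
    have "x\<^sup>2 \<le> y\<^sup>2"
      using that by (intro power_mono) auto
    moreover have "4 \<le> x\<^sup>2"
      using power_mono[OF that(1), of 2] by simp
    ultimately have "x + sqrt (x\<^sup>2 - 4) \<le> y + sqrt (y\<^sup>2 - 4)" "0 < x + sqrt (x\<^sup>2 - 4)"
      using that by (auto intro!: add_mono add_pos_nonneg)
    then show ?thesis
      using that joukowski_inverse_pos(1)[of x] joukowski_inverse_pos(1)[of y]
      by (simp add: frac_le)
  qed
  show ?thesis
    using assms *[of x y] *[of "- y" "- x"] by (auto simp: joukowski_inverse_minus)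
qed

lemma joukowski_inverse_continuous:
  "continuous_on {2..} joukowski_inverse" "continuous_on {..- 2} joukowski_inverse"
proof -
  have "continuous_on {2..} (\<lambda>x::real. 2 / (x + sqrt (x\<^sup>2 - 4)))"
  proof (intro continuous_intros ballI)
    fix x :: real assume "x \<in> {2..}"
    then have "2 \<le> x"
      by simp
    moreover have "0 \<le> sqrt (x\<^sup>2 - 4)"
      using power_mono[of 2 x 2] \<open>2 \<le> x\<close> by simp
    ultimately show "x + sqrt (x\<^sup>2 - 4) \<noteq> 0"
      by linarith
  qed
  then show pos: "continuous_on {2..} joukowski_inverse"
    by (rule continuous_on_eq) (simp add: joukowski_inverse_pos(1))
  have "continuous_on {..- 2} (\<lambda>x. - joukowski_inverse (- x))"
    by (intro continuous_on_minus continuous_on_compose2[OF pos] continuous_intros) auto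
  then show "continuous_on {..- 2} joukowski_inverse"
    by (simp add: joukowski_inverse_minus)
qed

lemma joukowski_inverse_inverse:
  assumes "2 < \<bar>x\<bar>"
  shows "joukowski_inverse x \<noteq> 0" "\<bar>joukowski_inverse x\<bar> < 1"
    "joukowski_inverse x + inverse (joukowski_inverse x) = x"
proof -
  have *: "joukowski_inverse x \<noteq> 0 \<and> \<bar>joukowski_inverse x\<bar> < 1 \<and>
      joukowski_inverse x + inverse (joukowski_inverse x) = x" if "2 < x" for x
    using joukowski_inverse_pos[of x] that by auto
  show "joukowski_inverse x \<noteq> 0" "\<bar>joukowski_inverse x\<bar> < 1"
    "joukowski_inverse x + inverse (joukowski_inverse x) = x"
    using assms *[of x] *[of "- x"] by (auto simp: joukowski_inverse_minus abs_if split: if_splits)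
qed

text \<open>
  The second solution is \<open>1/s\<close>, which lies outside the unit disc.
\<close>

lemma joukowski_inverse_unique:
  assumes z: "z \<noteq> 0" "cmod z < 1" and eq: "z + inverse z = of_real x" and x: "2 < \<bar>x\<bar>"
  shows "z = of_real (joukowski_inverse x)"
proof -
  define s where "s = joukowski_inverse x"
  have s: "s \<noteq> 0" "\<bar>s\<bar> < 1" "s + inverse s = x"
    using joukowski_inverse_inverse[OF x] by (simp_all add: s_def)
  have "z + inverse z = of_real s + inverse (of_real s)"
    unfolding eq s(3)[symmetric] by simp
  then have "(z - of_real s) * (z * of_real s - 1) = 0"
    using z(1) s(1) by (simp add: field_simps)
  moreover have "cmod (z * of_real s) < 1 * 1"
    unfolding norm_mult using z(2) s(2) by (intro mult_strict_mono) auto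
  then have "z * of_real s \<noteq> 1"
    by auto
  ultimately show ?thesis
    by (simp add: s_def)
qed

section \<open>Eigenvalues and resonances of finitely supported perturbations\<close>

text \<open>
  The entry of index \<open>k\<close> is the last one different from \<open>0\<close>; it is \<open>a\<^sub>p - 1\<close> or \<open>b\<^sub>p\<close> according to parity.
\<close>

lemma perturbation_in_X_class:
  assumes p: "1 \<le> p" and k: "k \<in> {2 * p - 1, 2 * p}" and q: "perturbation a b \<in> X_class k"
  shows "\<And>x. p < x \<Longrightarrow> a x = 1 \<and> b x = 0"
    and "k = 2 * p \<and> a p \<noteq> 1 \<or> k = 2 * p - 1 \<and> a p = 1 \<and> b p \<noteq> 0"
proof -
  have zero: "perturbation a b x = 0" if "k < x" for x
    using q that by (simp add: X_class_def)
  have nz: "perturbation a b k \<noteq> 0"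
    using q by (simp add: X_class_def)
  have even: "perturbation a b (2 * x) = a x - 1" for x
    by (simp add: perturbation_def)
  have odd: "perturbation a b (2 * x - 1) = b x" if "1 \<le> x" for x
    using that by (simp add: perturbation_def)
  show "a x = 1 \<and> b x = 0" if "p < x" for x
    using zero[of "2 * x"] zero[of "2 * x - 1"] even[of x] odd[of x] k that by auto
  show "k = 2 * p \<and> a p \<noteq> 1 \<or> k = 2 * p - 1 \<and> a p = 1 \<and> b p \<noteq> 0"
    using k nz zero[of "2 * p"] even[of p] odd[OF p] p by auto
qed

theorem theorem1p1:
  fixes p k n_minus n_plus :: nat
    and a b :: "nat \<Rightarrow> real"
    and lam :: "int \<Rightarrow> real"
    and \<mu> \<tau> \<alpha>m \<alpha>p :: "nat \<Rightarrow> real"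
    and \<psi> :: "nat \<Rightarrow> complex \<Rightarrow> complex"
  assumes p_pos: "p \<ge> 1"
    and k_cases: "k \<in> {2 * p - 1, 2 * p}"
    and a0: "a 0 = 1"
    and a_pos: "\<forall>x\<ge>1. a x > 0"
    and a_bounded: "bounded (a ` {1..})"
    and b_bounded: "bounded (b ` {1..})"
    and q: "perturbation a b \<in> X_class k"
    and lam_minus: "strict_mono_on {1..n_minus} (\<lambda>j. lam (- int j))"
      "\<forall>j\<in>{1..n_minus}. lam (- int j) < -2"
    and lam_plus: "strict_antimono_on {1..n_plus} (\<lambda>j. lam (int j))"
      "\<forall>j\<in>{1..n_plus}. lam (int j) > 2"
    and lam_all: "{e. jacobi_eigenvalue a b e} =
      complex_of_real ` ((\<lambda>j. lam (- int j)) ` {1..n_minus} \<union> (\<lambda>j. lam (int j)) ` {1..n_plus})"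
    and mu: "eigenvalue_enum (jacobi_mat a b p) {0..<p} \<mu>"
    and tau: "eigenvalue_enum (jacobi_mat_trunc a b p) {1..<p} \<tau>"
    and alpha_minus: "eigenvalue_enum (jacobi_mat_minus a b p) {1..p} \<alpha>m"
    and alpha_plus: "eigenvalue_enum (jacobi_mat_plus a b p) {1..p} \<alpha>p"
    and jost: "jost_solution a b p \<psi>"
  shows "n_minus = eigenvalue_count (jacobi_mat_minus a b p) {..< -2} \<and> n_minus \<le> p \<and>
    n_plus = eigenvalue_count (jacobi_mat_plus a b p) {2 <..} \<and> n_plus \<le> p \<and>
    n_minus + n_plus \<le> k div 2 + 1 \<and>
    (n_minus \<ge> 1 \<longrightarrow>
      (\<forall>j. 1 \<le> j \<and> j \<le> n_minus - 1 \<longrightarrow>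
        \<alpha>m j < lam (- int j) \<and> lam (- int j) < \<mu> (j - 1) \<and> \<mu> (j - 1) < \<alpha>p j \<and>
        \<alpha>p j < \<tau> j \<and> \<tau> j < \<alpha>m (j + 1)) \<and>
      \<alpha>m n_minus < lam (- int n_minus) \<and>
      lam (- int n_minus) < min (-2) (\<alpha>p n_minus)) \<and>
    (n_plus \<ge> 1 \<longrightarrow>
      (\<forall>j. 1 \<le> j \<and> j \<le> n_plus - 1 \<longrightarrow>
        \<alpha>p (p - j) < \<tau> (p - j) \<and> \<tau> (p - j) < \<alpha>m (p - j + 1) \<and>
        \<alpha>m (p - j + 1) < \<mu> (p - j) \<and> \<mu> (p - j) < lam (int j) \<and>
        lam (int j) < \<alpha>p (p - j + 1)) \<and>
      max 2 (\<alpha>m (p - n_plus + 1)) < lam (int n_plus) \<and>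
      lam (int n_plus) < \<alpha>p (p - n_plus + 1)) \<and>
    (k > 1 \<longrightarrow> resonance_count (\<psi> 0) \<ge> p - 1)"
proof -
  define A where "A = (a p)\<^sup>2"
  define f g where "f = (jacobi_poly a b (Suc p) :: real poly)" and "g = (jacobi_poly a b p :: real poly)"
  define m where "m x = poly f x / poly g x" for x
  define h where "h x = A * joukowski_inverse x" for x
  define \<mu>' where "\<mu>' j = \<mu> (j - 1)" for j
  have pos: "0 < a n" for n
    using a_pos a0 by (cases n) auto
  have A_pos: "0 < A"
    using pos[of p] by (simp add: A_def)
  note tail = perturbation_in_X_class[OF p_pos k_cases q]
  have jacobi_mat_eigenvalue: "eigenvalue (jacobi_mat a (b(p := b p + c)) p) x \<longleftrightarrow> poly f x = c * poly g x" for c x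
    using eigenvalue_jacobi_mat_iff[of a "b(p := b p + c)" p x, OF pos]
    unfolding jacobi_poly_last_shift[OF p_pos] by (simp add: f_def g_def)
  have poles: "\<tau> ` {1..<p} = {x. poly g x = 0}"
    using tau eigenvalue_jacobi_mat_iff[of a b "p - 1", OF pos] p_pos
    unfolding jacobi_mat_trunc_eq by (simp add: eigenvalue_enum_def g_def)
  interpret increasing_branches p \<tau> m
  proof
    fix x y :: real
    assume "{x..y} \<inter> \<tau> ` {1..<p} = {}"
    then have g: "poly g w \<noteq> 0" if "w \<in> {x..y}" for w
      using that unfolding poles by auto
    show "y - x \<le> m y - m x" if "x \<le> y"
      using jacobi_ratio_slope[OF that, of a b p] g by (simp add: m_def f_def g_def)
    show "continuous_on {x..y} m"
      unfolding m_def using g by (intro continuous_intros) auto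
  qed (use p_pos tau in \<open>simp_all add: eigenvalue_enum_def\<close>)
  \<comment> \<open>A common zero of numerator and denominator is impossible, so the polynomial equation never hides
    a pole.\<close>
  have root_level: "poly f x = c * poly g x \<longleftrightarrow> x \<notin> poles \<and> m x = c" for x c
    using jacobi_poly_no_common_root[of a b p x, OF pos] unfolding poles
    by (auto simp: m_def f_def g_def field_simps)
  have level: "level_points c r"
    if "strict_mono_on {1..p} r" "r ` {1..p} = {e. eigenvalue (jacobi_mat a (b(p := b p + c)) p) e}" for c r
    using that unfolding jacobi_mat_eigenvalue root_level level_points_def by blast
  have level_minus: "level_points (- A) \<alpha>m"
    using level[of \<alpha>m "- A"] alpha_minus by (simp add: eigenvalue_enum_def jacobi_mat_minus_eq A_def)
  have level_plus: "level_points A \<alpha>p"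
    using level[of \<alpha>p A] alpha_plus by (simp add: eigenvalue_enum_def jacobi_mat_plus_eq A_def)
  have level_0: "level_points 0 \<mu>'"
  proof (rule level)
    have mono: "strict_mono_on {0..<p} \<mu>" and im: "\<mu> ` {0..<p} = {e. eigenvalue (jacobi_mat a b p) e}"
      using mu by (simp_all add: eigenvalue_enum_def)
    show "strict_mono_on {1..p} \<mu>'"
      unfolding \<mu>'_def by (intro strict_mono_onI strict_mono_onD[OF mono]) auto
    have "(\<lambda>j. j - 1) ` {1..p} = {0..<p}"
    proof (intro equalityI subsetI)
      fix i assume "i \<in> {0..<p}"
      then show "i \<in> (\<lambda>j. j - 1) ` {1..p}"
        by (intro image_eqI[of _ _ "Suc i"]) auto
    qed auto
    then have "\<mu>' ` {1..p} = \<mu> ` {0..<p}"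
      unfolding \<mu>'_def by (metis image_image)
    then show "\<mu>' ` {1..p} = {e. eigenvalue (jacobi_mat a (b(p := b p + 0)) p) e}"
      using im by simp
  qed

  have prod_nz: "(\<Prod>i\<le>p. complex_of_real (a i)) \<noteq> 0"
    using pos by (simp add: less_imp_neq[THEN not_sym])
  have jost_eq: "(\<Prod>i\<le>p. complex_of_real (a i)) * \<psi> 0 z = poly (jost_poly a b p) z" if "z \<noteq> 0" for z
    using jost_function_eq[of a p b \<psi> z] pos tail(1) jost that by blast
  have eigenvalue_iff: "jacobi_eigenvalue a b (z + inverse z) \<longleftrightarrow> poly (jost_poly a b p) z = 0"
    if "z \<noteq> 0" "cmod z < 1" for z
    using jacobi_eigenvalue_iff_jost_function_zero[of a p b \<psi> z] pos tail(1) jost that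
      jost_eq[OF that(1)] prod_nz
    by fastforce
  have crossing_iff: "jacobi_eigenvalue a b (of_real x) \<longleftrightarrow> x \<notin> poles \<and> m x = h x" if "2 < \<bar>x\<bar>" for x
  proof -
    let ?s = "joukowski_inverse x"
    note s = joukowski_inverse_inverse[OF that]
    have "complex_of_real x = of_real ?s + inverse (of_real ?s)"
      using arg_cong[OF s(3), of complex_of_real] by simp
    then have "jacobi_eigenvalue a b (of_real x) \<longleftrightarrow> poly (jost_poly a b p) ?s = 0"
      using eigenvalue_iff[of "of_real ?s"] s by (simp add: poly_jost_poly_of_real)
    also have "\<dots> \<longleftrightarrow> poly f x = h x * poly g x"
      using poly_jost_poly[OF s(1), of a b p] s(1) unfolding s(3) by (simp add: f_def g_def h_def A_def)
    finally show ?thesis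
      unfolding root_level .
  qed
  define L where "L = (\<lambda>j. lam (- int j)) ` {1..n_minus} \<union> (\<lambda>j. lam (int j)) ` {1..n_plus}"
  have L: "jacobi_eigenvalue a b e \<longleftrightarrow> e \<in> complex_of_real ` L" for e
    using lam_all unfolding L_def by blast
  have L_iff: "x \<in> L \<longleftrightarrow> x \<notin> poles \<and> m x = h x" if "2 < \<bar>x\<bar>" for x
    using crossing_iff[OF that] L[of "of_real x"] by auto
  have L_outside: "2 < \<bar>x\<bar>" if "x \<in> L" for x
    using that lam_minus(2) lam_plus(2) by (fastforce simp: L_def)
  have minus_im: "(\<lambda>j. lam (- int j)) ` {1..n_minus} = {x. x < - 2 \<and> x \<notin> poles \<and> m x = h x}" (is "?l = ?r")
  proof -
    have "?l = {x \<in> L. x < - 2}"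
      using lam_minus(2) lam_plus(2) by (fastforce simp: L_def)
    also have "\<dots> = ?r"
      using L_iff by fastforce
    finally show ?thesis .
  qed
  have plus_im: "(\<lambda>j. lam (int j)) ` {1..n_plus} = {x. 2 < x \<and> x \<notin> poles \<and> m x = h x}" (is "?l = ?r")
  proof -
    have "?l = {x \<in> L. 2 < x}"
      using lam_minus(2) lam_plus(2) by (fastforce simp: L_def)
    also have "\<dots> = ?r"
      using L_iff by fastforce
    finally show ?thesis .
  qed

  have h_anti: "h y \<le> h x" if "x \<le> y" "y \<le> - 2" for x y
    using joukowski_inverse_antimono[of x y] that A_pos by (simp add: h_def)
  have h_anti': "h y \<le> h x" if "x \<le> y" "2 \<le> x" for x y
    using joukowski_inverse_antimono[of x y] that A_pos by (simp add: h_def)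
  have h_cont: "continuous_on {..- 2} h" "continuous_on {2..} h"
    unfolding h_def by (intro continuous_intros joukowski_inverse_continuous)+
  have h_neg: "- A < h x" if "x < - 2" for x
    using mult_strict_left_mono[OF joukowski_inverse_neg(3)[of x] A_pos] that by (simp add: h_def)
  have h_neg': "h x < 0" if "x \<le> - 2" for x
    using mult_pos_neg[OF A_pos joukowski_inverse_neg(1)[OF that]] by (simp add: h_def)
  have h_pos: "h x < A" if "2 < x" for x
    using mult_strict_left_mono[OF joukowski_inverse_pos(4)[of x] A_pos] that by (simp add: h_def)
  have h_pos': "0 < h x" if "2 \<le> x" for x
    using mult_pos_pos[OF A_pos joukowski_inverse_pos(2)[OF that]] by (simp add: h_def)
  have h_ends: "h (- 2) = - A" "h 2 = A"
    by (simp_all add: h_def joukowski_inverse_ends)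
  note crossings_minus = crossings_below[OF level_minus level_0 h_anti h_cont(1) h_ends(1) h_neg h_neg'
    lam_minus(1) minus_im]
  have below: "n_minus = card {j \<in> {1..p}. \<alpha>m j < - 2}" "n_minus \<le> p"
    "\<And>j. j \<in> {1..n_minus} \<Longrightarrow> \<alpha>m j < lam (- int j) \<and> lam (- int j) < \<mu>' j \<and> lam (- int j) < - 2"
    using crossings_minus by blast+
  note crossings_plus = crossings_above[OF level_0 level_plus h_anti' h_cont(2) h_ends(2) h_pos h_pos'
    lam_plus(1) plus_im]
  have above: "n_plus = card {j \<in> {1..p}. 2 < \<alpha>p j}" "n_plus \<le> p"
    "\<And>j. j \<in> {1..n_plus} \<Longrightarrow> \<mu>' (p + 1 - j) < lam (int j) \<and> lam (int j) < \<alpha>p (p + 1 - j) \<and> 2 < lam (int j)"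
    using crossings_plus by blast+

  have minus_count: "n_minus = eigenvalue_count (jacobi_mat_minus a b p) {..< -2}"
    using eigenvalue_count_enum[OF _ alpha_minus, of "{..< -2}"] below(1) by (simp add: jacobi_mat_minus_def)
  have plus_count: "n_plus = eigenvalue_count (jacobi_mat_plus a b p) {2 <..}"
    using eigenvalue_count_enum[OF _ alpha_plus, of "{2 <..}"] above(1) by (simp add: jacobi_mat_plus_def)
  have minus: "\<alpha>m j < lam (- int j)" "lam (- int j) < \<mu> (j - 1)" "lam (- int j) < - 2" if "j \<in> {1..n_minus}" for j
    using below(3)[OF that] by (simp_all add: \<mu>'_def)
  have plus: "\<mu> (p - j) < lam (int j)" "lam (int j) < \<alpha>p (p - j + 1)" "2 < lam (int j)" if "j \<in> {1..n_plus}" for j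
  proof -
    have "p + 1 - j = p - j + 1"
      using above(2) that by (auto simp: Suc_diff_le)
    then show "\<mu> (p - j) < lam (int j)" "lam (int j) < \<alpha>p (p - j + 1)" "2 < lam (int j)"
      using above(3)[OF that] by (simp_all add: \<mu>'_def)
  qed
  have chain: "\<alpha>m j < \<mu> (j - 1)" "\<mu> (j - 1) < \<alpha>p j" if "j \<in> {1..p}" for j
    using level_points_less[OF level_minus level_0 _ that] level_points_less[OF level_0 level_plus _ that] A_pos
    by (simp_all add: \<mu>'_def)
  have gap: "\<alpha>p j < \<tau> j" "\<tau> j < \<alpha>m (j + 1)" if "j \<in> {1..<p}" for j
    using level_point_less_pole[OF level_plus that] pole_less_level_point[OF level_minus that] by simp_all

  have total: "n_minus + n_plus \<le> k div 2 + 1"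
  proof (rule ccontr)
    assume *: "\<not> n_minus + n_plus \<le> k div 2 + 1"
    \<comment> \<open>The lowest cell with an eigenvalue above \<open>2\<close>; if the bound fails, it also has one below \<open>-2\<close>.\<close>
    define j where "j = p - n_plus + 1"
    have j: "j \<in> {1..n_minus}" "n_plus \<in> {1..n_plus}"
      using * k_cases p_pos below(2) above(2) by (auto simp: j_def)
    have far: "2 < \<alpha>p j"
      using plus[OF j(2)] by (simp add: j_def)
    from tail(2) show False
    proof
      assume "k = 2 * p \<and> a p \<noteq> 1"
      \<comment> \<open>The next cell then has an eigenvalue below \<open>-2\<close> as well, although it lies to the right of
        \<open>\<alpha>p j > 2\<close>.\<close>
      then have j': "j \<in> {1..<p}" "j + 1 \<in> {1..n_minus}"
        using * below(2) above(2) by (auto simp: j_def)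
      then show False
        using far gap[OF j'(1)] minus[OF j'(2)] by simp
    next
      assume "k = 2 * p - 1 \<and> a p = 1 \<and> b p \<noteq> 0"
      then have "\<alpha>p j - \<alpha>m j \<le> 2"
        using level_points_gap[OF level_minus level_plus, of j] below(2) j(1) by (simp add: A_def)
      then show False
        using far minus[OF j(1)] by simp
    qed
  qed

  have resonance: "p - 1 \<le> resonance_count (\<psi> 0)"
  proof -
    let ?Q = "jost_poly a b p :: complex poly"
    let ?Z = "{z. cmod z < 1 \<and> poly ?Q z = 0}"
    \<comment> \<open>Zeros in the disc inject into the eigenvalues; in particular they are real, which makes the
      criterion for simplicity applicable.\<close>
    have Z: "\<exists>x\<in>L. z = of_real (joukowski_inverse x)" if root: "z \<in> ?Z" for z
    proof -
      have z: "z \<noteq> 0" "cmod z < 1"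
        using root by (auto simp: poly_jost_poly_0)
      then obtain x where x: "x \<in> L" "z + inverse z = of_real x"
        using eigenvalue_iff[OF z] L[of "z + inverse z"] root by auto
      then show ?thesis
        using joukowski_inverse_unique[OF z x(2) L_outside[OF x(1)]] by blast
    qed
    have fin: "finite L"
      by (simp add: L_def)
    have "card L \<le> card ((\<lambda>j. lam (- int j)) ` {1..n_minus}) + card ((\<lambda>j. lam (int j)) ` {1..n_plus})"
      unfolding L_def by (rule card_Un_le)
    also have "\<dots> \<le> n_minus + n_plus"
      using card_image_le[of "{1..n_minus}" "\<lambda>j. lam (- int j)"] card_image_le[of "{1..n_plus}" "\<lambda>j. lam (int j)"]
      by simp
    finally have "card L \<le> n_minus + n_plus" .
    moreover have "?Z \<subseteq> (\<lambda>x. of_real (joukowski_inverse x)) ` L"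
      using Z by blast
    then have "card ?Z \<le> card L"
      by (rule surj_card_le[OF fin])
    moreover have "degree ?Q \<le> resonance_count (\<psi> 0) + card ?Z"
    proof (rule resonance_count_ge[OF _ prod_nz])
      show "poly ?Q 0 \<noteq> 0"
        by (simp add: poly_jost_poly_0)
      show "(\<Prod>i\<le>p. complex_of_real (a i)) * \<psi> 0 z = poly ?Q z" if "z \<noteq> 0" for z
        by (rule jost_eq[OF that])
    next
      fix z assume z: "cmod z < 1" "poly ?Q z = 0"
      then obtain x where x: "x \<in> L" "z = of_real (joukowski_inverse x)"
        using Z by blast
      then show "poly (pderiv ?Q) z \<noteq> 0"
        using jost_poly_simple_root[of a "joukowski_inverse x" b p] pos
          joukowski_inverse_inverse(1,2)[OF L_outside[OF x(1)]] z(2)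
        by (simp add: poly_jost_poly_of_real poly_pderiv_jost_poly_of_real)
    qed
    moreover have "k \<le> degree ?Q"
      by (rule degree_jost_poly_ge) (use p_pos pos tail(2) in auto)
    ultimately show ?thesis
      using total k_cases by auto
  qed

  show ?thesis
  proof (intro conjI impI allI)
    show "n_minus = eigenvalue_count (jacobi_mat_minus a b p) {..< -2}"
      by (rule minus_count)
    show "n_plus = eigenvalue_count (jacobi_mat_plus a b p) {2 <..}"
      by (rule plus_count)
    show "n_minus \<le> p" "n_plus \<le> p"
      by (rule below(2) above(2))+
    show "n_minus + n_plus \<le> k div 2 + 1"
      by (rule total)
    show "p - 1 \<le> resonance_count (\<psi> 0)"
      by (rule resonance)
  next
    fix j assume "1 \<le> j \<and> j \<le> n_minus - 1"
    then have "j \<in> {1..n_minus}" "j \<in> {1..p}" "j \<in> {1..<p}"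
      using below(2) by auto
    then show "\<alpha>m j < lam (- int j)" "lam (- int j) < \<mu> (j - 1)" "\<mu> (j - 1) < \<alpha>p j"
      "\<alpha>p j < \<tau> j" "\<tau> j < \<alpha>m (j + 1)"
      using minus chain gap by blast+
  next
    assume "1 \<le> n_minus"
    then have "n_minus \<in> {1..n_minus}" "n_minus \<in> {1..p}"
      using below(2) by auto
    then show "\<alpha>m n_minus < lam (- int n_minus)" "lam (- int n_minus) < min (- 2) (\<alpha>p n_minus)"
      using minus[of n_minus] chain[of n_minus] by auto
  next
    fix j assume "1 \<le> j \<and> j \<le> n_plus - 1"
    then have "j \<in> {1..n_plus}" "p - j + 1 \<in> {1..p}" "p - j \<in> {1..<p}"
      using above(2) by auto
    then show "\<alpha>p (p - j) < \<tau> (p - j)" "\<tau> (p - j) < \<alpha>m (p - j + 1)" "\<alpha>m (p - j + 1) < \<mu> (p - j)"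
      "\<mu> (p - j) < lam (int j)" "lam (int j) < \<alpha>p (p - j + 1)"
      using plus[of j] chain[of "p - j + 1"] gap[of "p - j"] by simp_all
  next
    assume "1 \<le> n_plus"
    then have "n_plus \<in> {1..n_plus}" "p - n_plus + 1 \<in> {1..p}"
      using above(2) by auto
    then show "max 2 (\<alpha>m (p - n_plus + 1)) < lam (int n_plus)" "lam (int n_plus) < \<alpha>p (p - n_plus + 1)"
      using plus[of n_plus] chain[of "p - n_plus + 1"] by simp_all
  qed
qed

end
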